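(* Let $\Omega\subset\mathbb{R}^N$, $N\ge2$, be a bounded domain with $C^{2,\alpha}$ boundary, let $f$ satisfy the standing assumptions (A) and in addition $f\in C^2((0,+\infty))$, and let $u$ be the minimizer of $J(v)=\int_\Omega[f(|\nabla v|)-v]\,dx$ over $W^{1,\infty}_0(\Omega)$. Assume there exists a sequence $(f_n)$ of convex functions with $f_n(0)=0$, $f_n(s)/s\to\infty$ as $s\to\infty$, satisfying: (i) $f_n\in C^1([0,+\infty))\cap C^3((0,+\infty))$; (ii) $f_n\to f$ uniformly on compact subsets of $[0,+\infty)$; (iii) $f_n'(0)=0$, $f_n'$ decreases in $n$ to $f'$ and $f_n'\to f'$ uniformly on compact subsets of $[0,+\infty)$; (iv) $f_n''>0$ on $(0,+\infty)$; (v) $\lim_{s\to0^+}\frac{sf_n''(s)-f_n'(s)}{s^3}=0$ and $\lim_{s\to0^+}\frac{f_n'(s)}{s}=0$ for each $n$; (vi) $\lim_{n\to\infty}\frac{sf_n''(s)-f_n'(s)}{s^3}=0$ and $\lim_{n\to\infty}\frac{f_n'(s)}{s}=0$ uniformly on compact subsets of $[0,\sigma)$ (the functions being continuously extended by $0$ at $s=0$); (vii) $f_n''\to f''$ uniformly on compact subsets of $(0,+\infty)$. Then $u$ is a viscosity solution in $\Omega$ of $$\min\Big(-\frac{|\nabla u|f''(|\nabla u|)-f'(|\nabla u|)}{|\nabla u|^3}\Delta_\infty u-\frac{f'(|\nabla u|)}{|\nabla u|}\Delta u-1,\ |\nabla u|-\sigma\Big)=0,$$ i.e. of $G(\nabla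 u,D^2u)=0$ with $G(P,X)=\min\big(-\frac{|P|f''(|P|)-f'(|P|)}{|P|^3}P\cdot XP-\frac{f'(|P|)}{|P|}\operatorname{tr}X-1,\ |P|-\sigma\big)$, where the first entry is understood as $-1$ when $P=0$.
   Context: Standing assumptions (A) on $f:[0,+\infty)\to\mathbb{R}$: $f$ convex, nondecreasing, and there is $\sigma>0$ with $f\in C^1([0,+\infty))\cap C^3((\sigma,+\infty))$; $f(0)=0$ and $\lim_{s\to+\infty}f(s)/s=+\infty$; $f'(s)=0$ for $0\le s\le\sigma$; $f''(s)>0$ for $s>\sigma$. $\Delta_\infty u=\sum_{i,j}\partial_{ij}u\,\partial_iu\,\partial_ju$. Viscosity solutions of $G(\nabla v,D^2v)=0$: an u.s.c. $w$ is a subsolution if for every $x_0\in\Omega$ and $\phi\in C^2(\Omega)$ with $w(x_0)=\phi(x_0)$, $w<\phi$ elsewhere, one has $G(\nabla\phi(x_0),D^2\phi(x_0))\le0$; an l.s.c. $w$ is a supersolution if for $\phi$ touching from below strictly ($w(x_0)=\phi(x_0)$, $w>\phi$ elsewhere) one has $G(\nabla\phi(x_0),D^2\phi(x_0))\ge0$; a continuous $w$ is a solution if it is both. *)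

theory Defs
  imports "HOL-Analysis.Analysis"
begin

definition C2_on :: "(real^'n) set \<Rightarrow> (real^'n \<Rightarrow> real) \<Rightarrow> (real^'n \<Rightarrow> real^'n)
                     \<Rightarrow> (real^'n \<Rightarrow> real^'n^'n) \<Rightarrow> bool" where
  "C2_on U phi Dphi Hphi \<longleftrightarrow>
     (\<forall>x\<in>U. (phi has_derivative (\<lambda>h. Dphi x \<bullet> h)) (at x)
           \<and> (Dphi has_derivative (\<lambda>h. Hphi x *v h)) (at x))
     \<and> continuous_on U Hphi"

definition C2alpha_boundary :: "(real^'n) set \<Rightarrow> real \<Rightarrow> bool" where
  "C2alpha_boundary \<Omega> \<alpha> \<longleftrightarrow>
     (\<forall>z\<in>frontier \<Omega>. \<exists>r>0. \<exists>rho Drho Hrho C.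
        C2_on (ball z r) rho Drho Hrho
        \<and> (\<forall>x\<in>ball z r. \<forall>y\<in>ball z r. norm (Hrho x - Hrho y) \<le> C * dist x y powr \<alpha>)
        \<and> (\<forall>x\<in>ball z r. Drho x \<noteq> 0)
        \<and> \<Omega> \<inter> ball z r = {x\<in>ball z r. rho x < 0})"

(* W^{1,\<infinity>}_0(\<Omega>): Lipschitz functions vanishing outside \<Omega> (extension by zero) *)
definition W1inf0 :: "(real^'n) set \<Rightarrow> (real^'n \<Rightarrow> real) set" where
  "W1inf0 \<Omega> = {v. (\<exists>L. L-lipschitz_on UNIV v) \<and> (\<forall>x. x \<notin> \<Omega> \<longrightarrow> v x = 0)}"

(* pointwise gradient (exists a.e. for Lipschitz functions by Rademacher); 0 elsewhere *)
definition grad :: "(real^'n \<Rightarrow> real) \<Rightarrow> real^'n \<Rightarrow> real^'n" where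
  "grad v x = (if \<exists>g. (v has_derivative (\<lambda>h. g \<bullet> h)) (at x)
               then SOME g. (v has_derivative (\<lambda>h. g \<bullet> h)) (at x) else 0)"

definition Jfun :: "(real \<Rightarrow> real) \<Rightarrow> (real^'n) set \<Rightarrow> (real^'n \<Rightarrow> real) \<Rightarrow> real" where
  "Jfun f \<Omega> v = set_lebesgue_integral lebesgue \<Omega> (\<lambda>x. f (norm (grad v x)) - v x)"

definition Gop :: "(real \<Rightarrow> real) \<Rightarrow> (real \<Rightarrow> real) \<Rightarrow> real \<Rightarrow> real^'n \<Rightarrow> real^'n^'n \<Rightarrow> real" where
  "Gop f1 f2 \<sigma> P X =
     min (if P = 0 then -1
          else - ((norm P * f2 (norm P) - f1 (norm P)) / norm P ^ 3) * (P \<bullet> (X *v P))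
               - (f1 (norm P) / norm P) * trace X - 1)
         (norm P - \<sigma>)"

definition visc_sub :: "(real^'n \<Rightarrow> real^'n^'n \<Rightarrow> real) \<Rightarrow> (real^'n) set \<Rightarrow> (real^'n \<Rightarrow> real) \<Rightarrow> bool" where
  "visc_sub G \<Omega> w \<longleftrightarrow>
     (\<forall>x0\<in>\<Omega>. \<forall>phi Dphi Hphi. C2_on \<Omega> phi Dphi Hphi \<and> w x0 = phi x0
        \<and> (\<forall>x\<in>\<Omega>. x \<noteq> x0 \<longrightarrow> w x < phi x) \<longrightarrow> G (Dphi x0) (Hphi x0) \<le> 0)"

definition visc_super :: "(real^'n \<Rightarrow> real^'n^'n \<Rightarrow> real) \<Rightarrow> (real^'n) set \<Rightarrow> (real^'n \<Rightarrow> real) \<Rightarrow> bool" where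
  "visc_super G \<Omega> w \<longleftrightarrow>
     (\<forall>x0\<in>\<Omega>. \<forall>phi Dphi Hphi. C2_on \<Omega> phi Dphi Hphi \<and> w x0 = phi x0
        \<and> (\<forall>x\<in>\<Omega>. x \<noteq> x0 \<longrightarrow> w x > phi x) \<longrightarrow> G (Dphi x0) (Hphi x0) \<ge> 0)"

definition visc_solution :: "(real^'n \<Rightarrow> real^'n^'n \<Rightarrow> real) \<Rightarrow> (real^'n) set \<Rightarrow> (real^'n \<Rightarrow> real) \<Rightarrow> bool" where
  "visc_solution G \<Omega> w \<longleftrightarrow> continuous_on \<Omega> w \<and> visc_sub G \<Omega> w \<and> visc_super G \<Omega> w"

end

theory Submission
  imports Defs
begin

text \<open>
  The field \<open>A p = (f1 |p| / |p|) p\<close> is the gradient of the convex function \<open>p \<mapsto> f |p|\<close>, and it is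
  of class \<open>C\<^sup>1\<close> also across the degenerate ball \<open>|p| \<le> \<sigma>\<close>, where it vanishes. The first entry of the
  operator is \<open>- div (A (\<nabla>\<phi>)) - 1\<close>. If \<open>\<phi>\<close> touches \<open>u\<close> strictly from above at \<open>x0\<close> and this entry is
  positive at \<open>x0\<close>, compare \<open>u\<close> with \<open>v = u - w\<close>, \<open>w = (u - \<phi> + \<delta>)\<^sup>+\<close> localized near \<open>x0\<close>: convexity gives
  \<open>0 \<ge> J u - J v \<ge> \<integral> (A (\<nabla>\<phi>) \<bullet> \<nabla>w - w) = \<integral> (- div (A (\<nabla>\<phi>)) - 1) w > 0\<close>. Touching from below is
  the same statement for \<open>-u\<close> with the sign of the linear term reversed; there \<open>|\<nabla>\<phi>| < \<sigma>\<close> is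
  impossible because the first entry would be \<open>-1\<close>.

  The integration by parts for the Lipschitz function \<open>w\<close> and the meaning of \<open>grad\<close> rest on
  Rademacher's theorem. In one variable, a rescaled Lipschitz function \<open>F\<close> and \<open>x - F x\<close> define
  Stieltjes measures adding up to Lebesgue measure, and a Vitali covering shows that the set where
  the lower derivate is below \<open>p\<close> and the upper one above \<open>q > p\<close> is null.
\<close>

section \<open>Lipschitz functions of one variable\<close>

lemma continuous_on_increment_le:
  fixes F :: "real \<Rightarrow> real"
  assumes mF: "\<And>x y. x \<le> y \<Longrightarrow> F x \<le> F y"
    and lF: "\<And>x y. x \<le> y \<Longrightarrow> F y - F x \<le> y - x"
  shows "continuous_on UNIV F"
proof -
  have "1-lipschitz_on UNIV F"
  proof (rule lipschitz_onI)
    fix x y show "dist (F x) (F y) \<le> 1 * dist x y"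
      using mF[of x y] mF[of y x] lF[of x y] lF[of y x] by (auto simp: dist_real_def abs_if)
  qed simp
  then show ?thesis by (rule lipschitz_on_continuous_on)
qed

text \<open>Lebesgue measure is determined by its values on boxes, so it is enough that the
  increments of \<open>F\<close> and of \<open>x - F x\<close> over an interval add up to its
  length. Both functions are nondecreasing and continuous, hence both define Stieltjes measures
  without atoms.\<close>

lemma interval_measure_add_eq_lborel:
  fixes F :: "real \<Rightarrow> real"
  assumes mF: "\<And>x y. x \<le> y \<Longrightarrow> F x \<le> F y"
    and lF: "\<And>x y. x \<le> y \<Longrightarrow> F y - F x \<le> y - x"
    and A: "A \<in> sets borel"
  shows "emeasure (interval_measure F) A + emeasure (interval_measure (\<lambda>x. x - F x)) A
           = emeasure lborel A"
proof -
  let ?m = "\<lambda>A. emeasure (interval_measure F) A + emeasure (interval_measure (\<lambda>x. x - F x)) A"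
  define M where "M = measure_of UNIV (sets borel) ?m"
  have cF: "continuous_on UNIV F" by (rule continuous_on_increment_le[OF mF lF])
  then have cG: "continuous_on UNIV (\<lambda>x. x - F x)" by (intro continuous_intros)
  have mG: "x - F x \<le> y - F y" if "x \<le> y" for x y using lF[OF that] by simp
  have sa: "sigma_algebra UNIV (sets (borel :: real measure))"
    using sets.sigma_algebra_axioms[of "borel :: real measure"] by simp
  have emM: "emeasure M A = ?m A" if "A \<in> sets borel" for A
    unfolding M_def
  proof (rule emeasure_measure_of_sigma[OF sa _ _ that])
    show "positive (sets borel) ?m" by (simp add: positive_def)
    show "countably_additive (sets borel) ?m"
    proof (rule countably_additiveI)
      fix B :: "nat \<Rightarrow> real set" assume B: "range B \<subseteq> sets borel" "disjoint_family B"
      have "(\<Sum>i. ?m (B i)) = (\<Sum>i. emeasure (interval_measure F) (B i)) + (\<Sum>i. emeasure (interval_measure (\<lambda>x. x - F x)) (B i))"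
        by (rule suminf_add[symmetric]) auto
      then show "(\<Sum>i. ?m (B i)) = ?m (\<Union>i. B i)"
        using B by (simp add: suminf_emeasure)
    qed
  qed
  have "lborel = M"
  proof (rule lborel_eqI)
    show sM: "sets M = sets borel" unfolding M_def
      using sigma_algebra.sets_measure_of_eq[OF sa] by simp
    fix l u :: real assume "\<And>b. b \<in> Basis \<Longrightarrow> l \<bullet> b \<le> u \<bullet> b"
    then have lu: "l \<le> u" by auto
    have cb: "emeasure (interval_measure H) {a..b} = H b - H a" 
      if "\<And>x y. x \<le> y \<Longrightarrow> H x \<le> H y" "continuous_on UNIV H" "a \<le> b" for H :: "real \<Rightarrow> real" and a b
      using emeasure_interval_measure_Icc[OF that(3,1,2)] by simp
    \<comment> \<open>The formula \<open>cb\<close> is for closed intervals, while boxes are open;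
      null endpoints make the two measures equal.\<close>
    have pt: "emeasure M {a} = 0" for a
      using cb[OF mF cF, of a a] cb[OF mG cG, of a a] by (simp add: emM)
    show "emeasure M (box l u) = ennreal (\<Prod>b\<in>Basis. (u - l) \<bullet> b)"
    proof -
      have "emeasure M {l..u} \<le> emeasure M ({l<..<u} \<union> ({l} \<union> {u}))"
        by (rule emeasure_mono) (auto simp: sM)
      also have "\<dots> \<le> emeasure M {l<..<u} + emeasure M ({l} \<union> {u})"
        by (rule emeasure_subadditive) (auto simp: sM)
      also have "emeasure M ({l} \<union> {u}) \<le> emeasure M {l} + emeasure M {u}"
        by (rule emeasure_subadditive) (auto simp: sM)
      finally have 1: "emeasure M {l..u} \<le> emeasure M {l<..<u}" by (simp add: pt add_left_mono)
      have 2: "emeasure M {l<..<u} \<le> emeasure M {l..u}"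
        by (rule emeasure_mono) (auto simp: sM)
      have "emeasure M {l..u} = ennreal (F u - F l) + ennreal ((u - F u) - (l - F l))"
        using cb[OF mF cF lu] cb[OF mG cG lu] by (simp add: emM)
      also have "\<dots> = ennreal (u - l)"
        using mF[OF lu] mG[OF lu] by (subst ennreal_plus[symmetric]) auto
      finally show ?thesis using 1 2 by (simp add: box_real)
    qed
  qed
  then show ?thesis using emM[OF A] by simp
qed

text \<open>Vitali extracts from the short intervals of small slope a countable disjoint family
  inside an open set barely larger than \<open>S\<close>. It misses only a Lebesgue null part of
  \<open>S\<close>, which is also null for the Stieltjes measure because Lebesgue measure dominates
  it. Summing the slope bound over the family gives the factor \<open>p\<close>.\<close>

lemma interval_measure_le_of_Vitali_cover:
  fixes F :: "real \<Rightarrow> real"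
  assumes mF: "\<And>x y. x \<le> y \<Longrightarrow> F x \<le> F y"
    and lF: "\<And>x y. x \<le> y \<Longrightarrow> F y - F x \<le> y - x"
    and S: "S \<in> sets borel" and p: "0 \<le> p"
    and cov: "\<And>x d. x \<in> S \<Longrightarrow> 0 < d \<Longrightarrow>
        \<exists>a b. a < b \<and> x \<in> {a..b} \<and> b - a < d \<and> F b - F a \<le> p * (b - a)"
  shows "emeasure (interval_measure F) S \<le> ennreal p * emeasure lborel S"
proof -
  let ?\<mu> = "interval_measure F"
  have le: "emeasure ?\<mu> A \<le> emeasure lborel A" if "A \<in> sets borel" for A
    using interval_measure_add_eq_lborel[OF mF lF that] by (metis le_iff_add)
  have cF: "continuous_on UNIV F" by (rule continuous_on_increment_le[OF mF lF])
  have step: "emeasure ?\<mu> S \<le> ennreal p * (emeasure lborel S + ennreal e)" if "e > 0" for e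
  proof -
    obtain U where U: "open U" "S \<subseteq> U" "emeasure lborel (U - S) < ennreal e"
      using outer_regular_lborel[OF S \<open>e > 0\<close>] by blast
    \<comment> \<open>Intervals are indexed by their endpoints, and \<open>cb\<close> turns them
      into balls for the covering theorem. Staying inside \<open>U\<close> bounds the total length
      of a disjoint family by the measure of \<open>S\<close> plus \<open>e\<close>.\<close>
    define K where "K = {(a, b). a < b \<and> {a..b} \<subseteq> U \<and> F b - F a \<le> p * (b - a)}"
    let ?c = "\<lambda>(a::real, b). (a + b) / 2" and ?r = "\<lambda>(a::real, b). (b - a) / 2"
    have cb: "cball (?c i) (?r i) = {fst i..snd i}" for i
      by (cases i) (auto simp: cball_eq_atLeastAtMost field_simps)
    obtain C where C: "countable C" "C \<subseteq> K"
      "pairwise (\<lambda>i j. disjnt (cball (?c i) (?r i)) (cball (?c j) (?r j))) C"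
      "negligible (S - (\<Union>i\<in>C. cball (?c i) (?r i)))"
    proof (rule Vitali_covering_theorem_cballs[of K ?r S ?c])
      show "0 < ?r i" if "i \<in> K" for i using that by (auto simp: K_def)
      fix x d :: real assume x: "x \<in> S" and d: "0 < d"
      obtain d' where d': "d' > 0" "ball x d' \<subseteq> U" using U x open_contains_ball by blast
      obtain a b where ab: "a < b" "x \<in> {a..b}" "b - a < min d d'" "F b - F a \<le> p * (b - a)"
        using cov[OF x, of "min d d'"] d d' by auto
      have "{a..b} \<subseteq> ball x d'" using ab by (auto simp: dist_real_def)
      then have "(a, b) \<in> K" using ab d' by (auto simp: K_def)
      then show "\<exists>i. i \<in> K \<and> x \<in> cball (?c i) (?r i) \<and> ?r i < d"
        using ab by (intro exI[of _ "(a,b)"]) (auto simp: cball_eq_atLeastAtMost field_simps simp del: mem_cball)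
    qed blast
    let ?I = "\<lambda>i::real\<times>real. {fst i..snd i}"
    have dis: "disjoint_family_on ?I C"
      using C(3) by (auto simp: cb disjoint_family_on_def pairwise_def disjnt_def)
    have mU: "(\<Union>i\<in>C. ?I i) \<in> sets borel" using C(1) by (intro sets.countable_UN') auto
    have "S - (\<Union>i\<in>C. ?I i) \<in> null_sets lebesgue"
      using C(4) by (simp add: cb negligible_iff_null_sets)
    then have "emeasure lborel (S - (\<Union>i\<in>C. ?I i)) = 0"
      using S mU by (simp add: null_sets_def emeasure_completion)
    then have z: "emeasure ?\<mu> (S - (\<Union>i\<in>C. ?I i)) = 0"
      using le[of "S - (\<Union>i\<in>C. ?I i)"] S mU by simp
    have "emeasure ?\<mu> S \<le> emeasure ?\<mu> ((\<Union>i\<in>C. ?I i) \<union> (S - (\<Union>i\<in>C. ?I i)))"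
      by (rule emeasure_mono) (use S mU in auto)
    also have "\<dots> \<le> emeasure ?\<mu> (\<Union>i\<in>C. ?I i) + emeasure ?\<mu> (S - (\<Union>i\<in>C. ?I i))"
      by (rule emeasure_subadditive) (use S mU in auto)
    also have "\<dots> = (\<integral>\<^sup>+i. emeasure ?\<mu> (?I i) \<partial>count_space C)"
      unfolding z by (simp, rule emeasure_UN_countable) (use C dis in auto)
    also have "\<dots> \<le> (\<integral>\<^sup>+i. ennreal p * emeasure lborel (?I i) \<partial>count_space C)"
    proof (rule nn_integral_mono)
      fix i assume "i \<in> space (count_space C)"
      then have "i \<in> K" using C by auto
      then obtain a b where i: "i = (a, b)" "a < b" "F b - F a \<le> p * (b - a)" by (auto simp: K_def)
      have "emeasure ?\<mu> {a..b} = ennreal (F b - F a)"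
        using i by (intro emeasure_interval_measure_Icc mF cF) auto
      also have "\<dots> \<le> ennreal (p * (b - a))" using i by (intro ennreal_leI) auto
      also have "\<dots> = ennreal p * emeasure lborel {a..b}"
        using i p by (simp add: ennreal_mult)
      finally show "emeasure ?\<mu> (?I i) \<le> ennreal p * emeasure lborel (?I i)" using i by simp
    qed
    also have "\<dots> = ennreal p * (\<integral>\<^sup>+i. emeasure lborel (?I i) \<partial>count_space C)"
      by (rule nn_integral_cmult) simp
    also have "(\<integral>\<^sup>+i. emeasure lborel (?I i) \<partial>count_space C) = emeasure lborel (\<Union>i\<in>C. ?I i)"
      by (rule emeasure_UN_countable[symmetric]) (use C dis in auto)
    also have "emeasure lborel (\<Union>i\<in>C. ?I i) \<le> emeasure lborel (S \<union> (U - S))"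
    proof (rule emeasure_mono)
      have "?I i \<subseteq> U" if "i \<in> C" for i using that C(2) by (cases i) (auto simp: K_def)
      then show "(\<Union>i\<in>C. ?I i) \<subseteq> S \<union> (U - S)" by blast
    qed (use S U in auto)
    also have "emeasure lborel (S \<union> (U - S)) \<le> emeasure lborel S + emeasure lborel (U - S)"
      by (rule emeasure_subadditive) (use S U in auto)
    also have "\<dots> \<le> emeasure lborel S + ennreal e" using U by (intro add_left_mono) auto
    finally show ?thesis by (simp add: mult_left_mono)
  qed
  show ?thesis
  proof (rule ennreal_le_epsilon)
    fix e :: real assume e: "0 < e"
    \<comment> \<open>Dividing by \<open>p + 1\<close> keeps the error
      \<open>p * (e / (p + 1))\<close> below \<open>e\<close> and makes sense for
      \<open>p = 0\<close> too.\<close>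
    have "emeasure ?\<mu> S \<le> ennreal p * (emeasure lborel S + ennreal (e / (p + 1)))"
      using e p by (intro step) auto
    also have "\<dots> = ennreal p * emeasure lborel S + ennreal (p * (e / (p + 1)))"
      using p e ennreal_mult[of p "e / (p + 1)"] by (simp add: distrib_left)
    also have "\<dots> \<le> ennreal p * emeasure lborel S + ennreal e"
      using p e by (intro add_left_mono ennreal_leI) (auto simp: field_simps)
    finally show "emeasure ?\<mu> S \<le> ennreal p * emeasure lborel S + ennreal e" .
  qed
qed

section \<open>Oscillating difference quotients, on the line and along a direction\<close>

lemma frequently_at_0_iff:
  fixes P :: "real \<Rightarrow> bool"
  shows "(\<exists>\<^sub>F t in at 0. P t) \<longleftrightarrow> (\<forall>d>0. \<exists>t. t \<noteq> 0 \<and> \<bar>t\<bar> < d \<and> P t)"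
  unfolding frequently_def eventually_at by (auto simp: dist_real_def)

text \<open>The union over uncountably many \<open>t\<close> is harmless because each member is
  open; only the bound on the size of \<open>t\<close> has to run through a countable family. The
  set is thus a countable intersection of open sets.\<close>

lemma borel_frequently_quotient_less:
  fixes u :: "'a::euclidean_space \<Rightarrow> real"
  assumes u: "continuous_on UNIV u"
  shows "{x. \<exists>\<^sub>F t in at 0. (u (x + t *\<^sub>R v) - u x) / t < p} \<in> sets borel"
proof -
  let ?Q = "\<lambda>x t. (u (x + t *\<^sub>R v) - u x) / t"
  have eq: "{x. \<exists>\<^sub>F t in at 0. ?Q x t < p}
     = (\<Inter>k::nat. \<Union>t\<in>{t. t \<noteq> 0 \<and> \<bar>t\<bar> < 1 / real (Suc k)}. {x. ?Q x t < p})" (is "?A = ?B")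
  proof (intro equalityI subsetI)
    fix x assume "x \<in> ?B"
    then have B: "\<exists>t. t \<noteq> 0 \<and> \<bar>t\<bar> < 1 / real (Suc k) \<and> ?Q x t < p" for k by auto
    show "x \<in> ?A" unfolding mem_Collect_eq frequently_at_0_iff
    proof (intro allI impI)
      fix d :: real assume "d > 0"
      then obtain k where "1 / real (Suc k) < d" using nat_approx_posE by metis
      then show "\<exists>t. t \<noteq> 0 \<and> \<bar>t\<bar> < d \<and> ?Q x t < p" using B[of k] by force
    qed
  next
    fix x assume "x \<in> ?A"
    then have "\<exists>t. t \<noteq> 0 \<and> \<bar>t\<bar> < 1 / real (Suc k) \<and> ?Q x t < p" for k
      unfolding mem_Collect_eq frequently_at_0_iff by simp
    then show "x \<in> ?B" by blast
  qed
  \<comment> \<open>For \<open>t = 0\<close> the quotient is constantly 0 by the convention on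
    division.\<close>
  have "continuous_on UNIV (\<lambda>x. ?Q x t)" for t
    by (cases "t = 0") (auto intro!: continuous_intros continuous_on_compose2[OF u])
  then have "open {x. ?Q x t < p}" for t
    using open_Collect_less[OF _ continuous_on_const] by blast
  then show ?thesis unfolding eq
    by (intro sets.countable_INT'' borel_open open_UN) auto
qed

lemma borel_frequently_quotient_greater:
  fixes u :: "'a::euclidean_space \<Rightarrow> real"
  assumes u: "continuous_on UNIV u"
  shows "{x. \<exists>\<^sub>F t in at 0. (u (x + t *\<^sub>R v) - u x) / t > q} \<in> sets borel"
proof -
  have "(- u (x + t *\<^sub>R v) - - u x) / t = - ((u (x + t *\<^sub>R v) - u x) / t)" for x t
    by (simp add: minus_divide_left)
  then show ?thesis
    using borel_frequently_quotient_less[of "\<lambda>x. - u x" v "-q"] u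
    by (simp add: continuous_on_minus)
qed

text \<open>On the exceptional set the measure of \<open>F\<close> is at most \<open>p'\<close>
  times Lebesgue measure, and that of \<open>x - F x\<close> at most \<open>1 - q'\<close> times it.
  As the two add up to Lebesgue measure and \<open>p' + (1 - q') < 1\<close>, every bounded piece is
  null.\<close>

lemma lipschitz_oscillation_null:
  fixes g :: "real \<Rightarrow> real"
  assumes g: "L-lipschitz_on UNIV g" and pq: "p < q"
  shows "emeasure lborel {x. (\<exists>\<^sub>F t in at 0. (g (x + t) - g x) / t < p) \<and>
                             (\<exists>\<^sub>F t in at 0. (g (x + t) - g x) / t > q)} = 0"
    (is "emeasure lborel ?E = 0")
proof -
  have cg: "continuous_on UNIV g" using g by (rule lipschitz_on_continuous_on)
  have E: "?E \<in> sets borel"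
  proof -
    have "?E = {x. \<exists>\<^sub>F t in at 0. (g (x + t *\<^sub>R 1) - g x) / t < p} \<inter>
               {x. \<exists>\<^sub>F t in at 0. (g (x + t *\<^sub>R 1) - g x) / t > q}" by (simp add: Collect_conj_eq)
    also have "\<dots> \<in> sets borel"
      by (intro sets.Int borel_frequently_quotient_less borel_frequently_quotient_greater cg)
    finally show ?thesis .
  qed
  \<comment> \<open>The summand 1 keeps \<open>K\<close> positive when \<open>L = 0\<close>, since
    \<open>2 * K\<close> is a divisor below.\<close>
  define K where "K = L + 1"
  have K: "K > 0" using lipschitz_on_nonneg[OF g] by (simp add: K_def)
  have gK: "\<bar>g y - g x\<bar> \<le> K * (y - x)" if "x \<le> y" for x y
  proof -
    have "\<bar>g y - g x\<bar> \<le> L * (y - x)" using lipschitz_onD[OF g, of y x] that by (simp add: dist_real_def)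
    also have "\<dots> \<le> K * (y - x)" using that by (intro mult_right_mono) (auto simp: K_def)
    finally show ?thesis .
  qed
  \<comment> \<open>A slope \<open>s\<close> of \<open>g\<close> lies between \<open>-K\<close> and
    \<open>K\<close> and becomes the slope \<open>(s + K) / (2 * K)\<close> of \<open>F\<close>,
    hence one in [0, 1]; \<open>p'\<close> and \<open>q'\<close> are the images of \<open>p\<close>
    and \<open>q\<close>.\<close>
  define F where "F = (\<lambda>t. (g t + K * t) / (2 * K))"
  define p' where "p' = (p + K) / (2 * K)"
  define q' where "q' = (q + K) / (2 * K)"
  have pq': "p' < q'" using pq K by (simp add: p'_def q'_def divide_strict_right_mono)
  have mF: "F x \<le> F y" if "x \<le> y" for x y
    unfolding F_def using gK[OF that] K
    by (intro divide_right_mono) (auto simp: abs_le_iff algebra_simps)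
  have lF: "F y - F x \<le> y - x" if "x \<le> y" for x y
  proof -
    have "F y - F x = ((g y - g x) + K * (y - x)) / (2 * K)"
      by (simp add: F_def diff_divide_distrib[symmetric] algebra_simps)
    also have "\<dots> \<le> (2 * K * (y - x)) / (2 * K)"
      using gK[OF that] K by (intro divide_right_mono) (auto simp: abs_le_iff)
    finally show ?thesis using K by simp
  qed
  have mG: "x - F x \<le> y - F y" if "x \<le> y" for x y using lF[OF that] by simp
  have lG: "(y - F y) - (x - F x) \<le> y - x" if "x \<le> y" for x y using mF[OF that] by simp
  have Fq: "(F (x + t) - F x) / t = ((g (x + t) - g x) / t + K) / (2 * K)" if "t \<noteq> 0" for x t
    using that K by (simp add: F_def field_simps)
  have Gq: "((x + t - F (x + t)) - (x - F x)) / t = 1 - (F (x + t) - F x) / t" if "t \<noteq> 0" for x t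
    using that by (simp add: field_simps)
  \<comment> \<open>For negative \<open>t\<close> the interval is \<open>{x + t..x}\<close>; so
    quotients on either side yield intervals containing \<open>x\<close>.\<close>
  have ex: "\<exists>a b. a < b \<and> x \<in> {a..b} \<and> b - a < d \<and> H b - H a \<le> r * (b - a)"
    if "t \<noteq> 0" "\<bar>t\<bar> < d" "(H (x + t) - H x) / t < r" for H :: "real \<Rightarrow> real" and x t d r
  proof (cases "t > 0")
    case True
    then show ?thesis using that
      by (intro exI[of _ x] exI[of _ "x + t"]) (auto simp: divide_less_eq)
  next
    case False
    then show ?thesis using that
      by (intro exI[of _ "x + t"] exI[of _ x]) (auto simp: divide_less_eq algebra_simps)
  qed
  \<comment> \<open>Truncation makes the measure finite, so that it can be cancelled in the final
    inequality.\<close>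
  have null: "emeasure lborel (?E \<inter> {-real n..real n}) = 0" for n
  proof (cases "?E \<inter> {-real n..real n} = {}")
    case False
    let ?S = "?E \<inter> {-real n..real n}"
    have S: "?S \<in> sets borel" using E by auto
    have lo: "\<exists>t. t \<noteq> 0 \<and> \<bar>t\<bar> < d \<and> (F (x + t) - F x) / t < p'" if "x \<in> ?E" "d > 0" for x d
    proof -
      have "\<exists>\<^sub>F t in at 0. (g (x + t) - g x) / t < p" using that by blast
      then obtain t where t: "t \<noteq> 0" "\<bar>t\<bar> < d" "(g (x + t) - g x) / t < p"
        using \<open>d > 0\<close> unfolding frequently_at_0_iff by blast
      then show ?thesis using K
        by (intro exI[of _ t]) (simp add: Fq p'_def divide_strict_right_mono)
    qed
    have hi: "\<exists>t. t \<noteq> 0 \<and> \<bar>t\<bar> < d \<and> ((x + t - F (x + t)) - (x - F x)) / t < 1 - q'" if "x \<in> ?E" "d > 0" for x d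
    proof -
      have "\<exists>\<^sub>F t in at 0. (g (x + t) - g x) / t > q" using that by blast
      then obtain t where t: "t \<noteq> 0" "\<bar>t\<bar> < d" "(g (x + t) - g x) / t > q"
        using \<open>d > 0\<close> unfolding frequently_at_0_iff by blast
      then have "q' < (F (x + t) - F x) / t"
        using K by (simp add: Fq q'_def divide_strict_right_mono)
      then have "((x + t - F (x + t)) - (x - F x)) / t < 1 - q'" using Gq[OF t(1), of x] by linarith
      then show ?thesis using t by blast
    qed
    have nn: "0 \<le> (H (x + t) - H x) / t" if "\<And>x y. x \<le> y \<Longrightarrow> H x \<le> H y" "t \<noteq> 0" 
      for H :: "real \<Rightarrow> real" and x t
      using that(1)[of x "x+t"] that(1)[of "x+t" x] that(2)
      by (cases "t > 0") (auto intro: divide_nonpos_nonpos)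
    \<comment> \<open>One point fixes the signs of \<open>p'\<close> and \<open>1 - q'\<close>:
      quotients of monotone functions are nonnegative, and at this point some of them fall below
      these numbers.\<close>
    from False obtain x where x: "x \<in> ?E" by blast
    have p0: "0 \<le> p'"
    proof -
      obtain t where t: "t \<noteq> 0" "(F (x + t) - F x) / t < p'" using lo[OF x zero_less_one] by blast
      then show ?thesis using nn[of F t x, OF mF] by linarith
    qed
    have q0: "0 \<le> 1 - q'"
    proof -
      obtain t where t: "t \<noteq> 0" "((x + t - F (x + t)) - (x - F x)) / t < 1 - q'"
        using hi[OF x zero_less_one] by blast
      then show ?thesis using nn[of "\<lambda>x. x - F x" t x, OF mG] by linarith
    qed
    have 1: "emeasure (interval_measure F) ?S \<le> ennreal p' * emeasure lborel ?S"
    proof (intro interval_measure_le_of_Vitali_cover mF lF S p0)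
      fix x d :: real assume "x \<in> ?S" "0 < d"
      then obtain t where "t \<noteq> 0" "\<bar>t\<bar> < d" "(F (x + t) - F x) / t < p'"
        using lo[of x d] by blast
      then show "\<exists>a b. a < b \<and> x \<in> {a..b} \<and> b - a < d \<and> F b - F a \<le> p' * (b - a)"
        by (rule ex[of t d F])
    qed
    have 2: "emeasure (interval_measure (\<lambda>x. x - F x)) ?S \<le> ennreal (1 - q') * emeasure lborel ?S"
    proof (intro interval_measure_le_of_Vitali_cover mG lG S q0)
      fix x d :: real assume "x \<in> ?S" "0 < d"
      then obtain t where "t \<noteq> 0" "\<bar>t\<bar> < d" "((x + t - F (x + t)) - (x - F x)) / t < 1 - q'"
        using hi[of x d] by blast
      then show "\<exists>a b. a < b \<and> x \<in> {a..b} \<and> b - a < d \<and> b - F b - (a - F a) \<le> (1 - q') * (b - a)"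
        by (rule ex[of t d "\<lambda>x. x - F x"])
    qed
    have "emeasure lborel ?S \<le> emeasure lborel {-real n..real n}" by (rule emeasure_mono) auto
    also have "\<dots> < \<infinity>" by simp
    finally have fin: "emeasure lborel ?S < \<infinity>" .
    then obtain m where m: "emeasure lborel ?S = ennreal m" "0 \<le> m" 
      by (cases "emeasure lborel ?S") auto
    have "emeasure lborel ?S = emeasure (interval_measure F) ?S + emeasure (interval_measure (\<lambda>x. x - F x)) ?S"
      by (rule interval_measure_add_eq_lborel[symmetric]) (use mF lF S in auto)
    also have "\<dots> \<le> ennreal p' * emeasure lborel ?S + ennreal (1 - q') * emeasure lborel ?S"
      using 1 2 by (rule add_mono)
    also have "\<dots> = ennreal (p' * m + (1 - q') * m)"
      using p0 q0 m by (simp add: ennreal_mult[symmetric] ennreal_plus[symmetric] del: ennreal_plus)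
    finally have "m \<le> p' * m + (1 - q') * m" using m p0 q0 by (simp add: ennreal_le_iff del: ennreal_plus)
    then have "(q' - p') * m \<le> 0" by (simp add: algebra_simps)
    then have "m = 0" using pq' m by (simp add: mult_le_0_iff)
    then show ?thesis using m by simp
  qed simp
  have "(\<Union>n. ?E \<inter> {-real n..real n}) \<in> null_sets lborel"
    using null E by (intro null_sets_UN) (auto simp: null_sets_def)
  moreover have "(\<Union>n. ?E \<inter> {-real n..real n}) = ?E"
  proof -
    have "\<exists>n. x \<in> {-real n..real n}" for x
    proof -
      obtain n where "\<bar>x\<bar> \<le> real n" using real_arch_simple by blast
      then have "x \<in> {-real n..real n}" by auto
      then show ?thesis by blast
    qed
    then show ?thesis by blast
  qed
  ultimately show ?thesis by (simp add: null_sets_def)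
qed

text \<open>Averaging over translates along \<open>v\<close> replaces a rotation of coordinates: by Tonelli and
  translation invariance, the measure of \<open>N\<close> is the integral over \<open>x\<close> of the measure of
  the part of the line through \<open>x\<close> that lies in \<open>N\<close>.\<close>

lemma null_if_null_along_lines:
  fixes N :: "'a::euclidean_space set"
  assumes N: "N \<in> sets borel"
    and lines: "\<And>x. emeasure lborel {t::real. x + t *\<^sub>R v \<in> N} = 0"
  shows "N \<in> null_sets lborel"
proof -
  have [measurable]: "N \<in> sets borel" by fact
  let ?f = "\<lambda>x (t::real). indicator N (x + t *\<^sub>R v) * indicator {0..1} t :: ennreal"
  have meas: "(\<lambda>(x, t). ?f x t) \<in> borel_measurable (lborel \<Otimes>\<^sub>M lborel)"
    unfolding split_def by measurable
  have tr: "(\<integral>\<^sup>+x. indicator N (x + t *\<^sub>R v) \<partial>lborel) = emeasure lborel N" for t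
  proof -
    have "emeasure lborel N = (\<integral>\<^sup>+x. indicator N x \<partial>distr lborel borel ((+) (t *\<^sub>R v)))"
      by (simp add: lborel_distr_plus)
    also have "\<dots> = (\<integral>\<^sup>+x. indicator N (t *\<^sub>R v + x) \<partial>lborel)"
      by (rule nn_integral_distr) auto
    finally show ?thesis by (simp add: add.commute)
  qed
  \<comment> \<open>The unit interval has length 1, so averaging over \<open>t\<close> in it leaves
    the measure unchanged.\<close>
  have "emeasure lborel N = (\<integral>\<^sup>+t. emeasure lborel N * indicator {0..1::real} t \<partial>lborel)"
    by (simp add: nn_integral_cmult)
  also have "\<dots> = (\<integral>\<^sup>+t. (\<integral>\<^sup>+x. ?f x t \<partial>lborel) \<partial>lborel)"
    by (simp add: nn_integral_multc tr)
  also have "\<dots> = (\<integral>\<^sup>+x. (\<integral>\<^sup>+t. ?f x t \<partial>lborel) \<partial>lborel)"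
    using lborel_pair.Fubini'[OF meas] by simp
  also have "\<dots> = (\<integral>\<^sup>+(x::'a). 0 \<partial>lborel)"
  proof (rule nn_integral_cong)
    fix x :: 'a
    have [measurable]: "{t. x + t *\<^sub>R v \<in> N} \<in> sets borel" by measurable
    have "(\<integral>\<^sup>+t. ?f x t \<partial>lborel) \<le> (\<integral>\<^sup>+t. indicator {t. x + t *\<^sub>R v \<in> N} t \<partial>lborel)"
      by (rule nn_integral_mono) (auto simp: indicator_def)
    also have "\<dots> = 0" using lines[of x] by simp
    finally show "(\<integral>\<^sup>+t. ?f x t \<partial>lborel) = 0" by simp
  qed
  finally show ?thesis using N by (simp add: null_sets_def)
qed

text \<open>The limit is the lower limit, written as the supremum of all eventual lower bounds. If
  \<open>h\<close> frequently stayed above it by a margin, two rationals in that margin would be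
  crossed infinitely often.\<close>

lemma bounded_convergent_or_oscillates:
  fixes h :: "'b \<Rightarrow> real"
  assumes F: "F \<noteq> bot" and bd: "\<forall>\<^sub>F t in F. \<bar>h t\<bar> \<le> L"
    and no: "\<And>p q. p \<in> \<rat> \<Longrightarrow> q \<in> \<rat> \<Longrightarrow> p < q \<Longrightarrow>
               \<not> ((\<exists>\<^sub>F t in F. h t < p) \<and> (\<exists>\<^sub>F t in F. h t > q))"
  shows "\<exists>l. (h \<longlongrightarrow> l) F"
proof -
  let ?A = "{a. \<forall>\<^sub>F t in F. a \<le> h t}"
  have ne: "-L \<in> ?A" using bd by (auto elim: eventually_mono)
  have ub: "a \<le> L" if "a \<in> ?A" for a
  proof -
    have "\<forall>\<^sub>F t in F. a \<le> h t \<and> \<bar>h t\<bar> \<le> L" using that bd by (auto intro: eventually_conj)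
    then have "\<exists>t. a \<le> h t \<and> \<bar>h t\<bar> \<le> L" using F eventually_happens by fastforce
    then show ?thesis by auto
  qed
  define l where "l = Sup ?A"
  have bdd: "bdd_above ?A" using ub by (auto simp: bdd_above_def)
  show ?thesis
  proof (intro exI order_tendstoI)
    fix a assume "a < l"
    then obtain b where "b \<in> ?A" "a < b" unfolding l_def using less_cSup_iff[OF _ bdd] ne by blast
    then show "\<forall>\<^sub>F t in F. a < h t" by (auto elim: eventually_mono)
  next
    fix a assume "l < a"
    obtain p where p: "p \<in> \<rat>" "l < p" "p < a" using Rats_dense_in_real[OF \<open>l < a\<close>] by blast
    obtain q where q: "q \<in> \<rat>" "p < q" "q < a" using Rats_dense_in_real[OF \<open>p < a\<close>] by blast
    have "p \<notin> ?A" using cSup_upper[OF _ bdd, of p] p by (auto simp: l_def)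
    then have "\<exists>\<^sub>F t in F. h t < p" by (simp add: frequently_def not_less)
    then have "\<not> (\<exists>\<^sub>F t in F. h t > q)" using no p q by blast
    then show "\<forall>\<^sub>F t in F. h t < a" using q by (auto simp: frequently_def not_less elim: eventually_mono)
  qed
qed

text \<open>Quotients are bounded, so where they do not converge they oscillate across one of
  countably many rational pairs. For each pair the exceptional set meets every line in direction
  \<open>v\<close> in a null set of parameters, by the case of one variable.\<close>

lemma lipschitz_directional_derivative_AE:
  fixes u :: "'a::euclidean_space \<Rightarrow> real"
  assumes u: "L-lipschitz_on UNIV u"
  shows "AE x in lborel. \<exists>l. ((\<lambda>t. (u (x + t *\<^sub>R v) - u x) / t) \<longlongrightarrow> l) (at 0)"
proof -
  let ?Q = "\<lambda>x t. (u (x + t *\<^sub>R v) - u x) / t"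
  have cu: "continuous_on UNIV u" using u by (rule lipschitz_on_continuous_on)
  define E where "E = (\<lambda>(p, q). {x. (\<exists>\<^sub>F t in at 0. ?Q x t < p) \<and> (\<exists>\<^sub>F t in at 0. ?Q x t > q)})"
  have E: "E (p, q) \<in> null_sets lborel" if "p < q" for p q
  proof (rule null_if_null_along_lines)
    have "E (p, q) = {x. \<exists>\<^sub>F t in at 0. ?Q x t < p} \<inter> {x. \<exists>\<^sub>F t in at 0. ?Q x t > q}"
      by (simp add: E_def Collect_conj_eq)
    also have "\<dots> \<in> sets borel"
      by (intro sets.Int borel_frequently_quotient_less borel_frequently_quotient_greater cu)
    finally show "E (p, q) \<in> sets borel" .
    fix x
    define g where "g = (\<lambda>t. u (x + t *\<^sub>R v))"
    have "(L * norm v)-lipschitz_on UNIV g"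
    proof (rule lipschitz_onI)
      fix s t :: real
      have "dist (g s) (g t) \<le> L * dist (x + s *\<^sub>R v) (x + t *\<^sub>R v)"
        unfolding g_def by (rule lipschitz_onD[OF u]) auto
      also have "\<dots> = L * norm v * dist s t"
        by (simp add: dist_norm scaleR_diff_left[symmetric])
      finally show "dist (g s) (g t) \<le> L * norm v * dist s t" .
    qed (use lipschitz_on_nonneg[OF u] in simp)
    from lipschitz_oscillation_null[OF this that]
    show "emeasure lborel {t. x + t *\<^sub>R v \<in> E (p, q)} = 0"
      by (simp add: E_def g_def scaleR_add_left add.assoc)
  qed
  have "(\<Union>i\<in>{(p, q). p \<in> \<rat> \<and> q \<in> \<rat> \<and> p < q}. E i) \<in> null_sets lborel"
  proof (rule null_sets_UN')
    show "countable {(p::real, q::real). p \<in> \<rat> \<and> q \<in> \<rat> \<and> p < q}"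
      by (rule countable_subset[OF _ countable_SIGMA[OF countable_rat, of "\<lambda>_. \<rat>"]]) (auto simp: countable_rat)
  qed (use E in auto)
  then show ?thesis
  proof (rule AE_I')
    show "{x \<in> space lborel. \<not> (\<exists>l. (?Q x \<longlongrightarrow> l) (at 0))} \<subseteq> (\<Union>i\<in>{(p, q). p \<in> \<rat> \<and> q \<in> \<rat> \<and> p < q}. E i)"
    proof clarify
      fix x assume "\<not> (\<exists>l. (?Q x \<longlongrightarrow> l) (at 0))"
      moreover have "\<forall>\<^sub>F t in at 0. \<bar>?Q x t\<bar> \<le> L * norm v"
        unfolding eventually_at
      proof (intro exI[of _ 1] conjI ballI impI)
        fix t :: real assume t: "t \<noteq> 0 \<and> dist t 0 < 1"
        have "\<bar>u (x + t *\<^sub>R v) - u x\<bar> \<le> L * (\<bar>t\<bar> * norm v)"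
          using lipschitz_onD[OF u, of "x + t *\<^sub>R v" x] by (simp add: dist_norm)
        then show "\<bar>?Q x t\<bar> \<le> L * norm v" using t by (simp add: abs_divide divide_le_eq mult_ac)
      qed simp
      ultimately obtain p q where "p \<in> \<rat>" "q \<in> \<rat>" "p < q"
        "\<exists>\<^sub>F t in at 0. ?Q x t < p" "\<exists>\<^sub>F t in at 0. ?Q x t > q"
        using bounded_convergent_or_oscillates[of "at (0::real)" "?Q x" "L * norm v"] by auto
      then show "x \<in> (\<Union>i\<in>{(p, q). p \<in> \<rat> \<and> q \<in> \<rat> \<and> p < q}. E i)"
        by (intro UN_I[of "(p, q)"]) (auto simp: E_def)
    qed
  qed
qed

section \<open>Rademacher's theorem\<close>

text \<open>The quotient with step \<open>1 / (k + 1)\<close>: a sequence of steps allows countable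
  limits and dominated convergence, and \<open>Suc\<close> excludes division by 0.\<close>

definition diffquot :: "('a::real_normed_vector \<Rightarrow> real) \<Rightarrow> 'a \<Rightarrow> nat \<Rightarrow> 'a \<Rightarrow> real" where
  "diffquot u v k x = real (Suc k) * (u (x + (1 / real (Suc k)) *\<^sub>R v) - u x)"

text \<open>As a \<open>lim\<close> of measurable functions this is total and Borel measurable; it
  is the directional derivative wherever the latter exists, so almost everywhere for Lipschitz
  functions.\<close>

definition dirderiv :: "('a::real_normed_vector \<Rightarrow> real) \<Rightarrow> 'a \<Rightarrow> 'a \<Rightarrow> real" where
  "dirderiv u v x = lim (\<lambda>k. diffquot u v k x)"

lemma diffquot_tendsto:
  assumes "((\<lambda>t. (u (x + t *\<^sub>R v) - u x) / t) \<longlongrightarrow> l) (at 0)"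
  shows "(\<lambda>k. diffquot u v k x) \<longlonglongrightarrow> l"
proof -
  have "filterlim (\<lambda>k. 1 / real (Suc k)) (at 0) sequentially"
    using LIMSEQ_inverse_real_of_nat by (auto simp: filterlim_at inverse_eq_divide)
  from filterlim_compose[OF assms this] show ?thesis
    by (simp add: diffquot_def mult.commute)
qed

lemma dirderiv_eqI:
  assumes "((\<lambda>t. (u (x + t *\<^sub>R v) - u x) / t) \<longlongrightarrow> l) (at 0)"
  shows "dirderiv u v x = l"
  unfolding dirderiv_def by (rule limI) (rule diffquot_tendsto[OF assms])

lemma dirderiv_AE:
  fixes u :: "'a::euclidean_space \<Rightarrow> real"
  assumes u: "L-lipschitz_on UNIV u"
  shows "AE x in lborel. ((\<lambda>t. (u (x + t *\<^sub>R v) - u x) / t) \<longlongrightarrow> dirderiv u v x) (at 0)"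
  using lipschitz_directional_derivative_AE[OF u, of v]
  by eventually_elim (auto dest: dirderiv_eqI)

lemma borel_measurable_diffquot [measurable]:
  fixes u :: "'a::euclidean_space \<Rightarrow> real"
  assumes [measurable]: "u \<in> borel_measurable borel"
  shows "diffquot u v k \<in> borel_measurable borel"
  unfolding diffquot_def by measurable

lemma borel_measurable_dirderiv [measurable]:
  fixes u :: "'a::euclidean_space \<Rightarrow> real"
  assumes [measurable]: "u \<in> borel_measurable borel"
  shows "dirderiv u v \<in> borel_measurable borel"
  unfolding dirderiv_def by measurable

lemma lipschitz_on_UNIV_borel_measurable:
  fixes u :: "'a::euclidean_space \<Rightarrow> real"
  shows "L-lipschitz_on UNIV u \<Longrightarrow> u \<in> borel_measurable borel"
  by (intro borel_measurable_continuous_onI lipschitz_on_continuous_on)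

lemma abs_diffquot_le:
  assumes u: "L-lipschitz_on UNIV u"
  shows "\<bar>diffquot u v k x\<bar> \<le> L * norm v"
proof -
  have "\<bar>u (x + (1 / real (Suc k)) *\<^sub>R v) - u x\<bar> \<le> L * norm ((1 / real (Suc k)) *\<^sub>R v)"
    using lipschitz_onD[OF u, of "x + (1 / real (Suc k)) *\<^sub>R v" x] by (simp add: dist_norm del: norm_scaleR)
  then have "real (Suc k) * \<bar>u (x + (1 / real (Suc k)) *\<^sub>R v) - u x\<bar> \<le> real (Suc k) * (L * norm ((1 / real (Suc k)) *\<^sub>R v))"
    by (rule mult_left_mono) simp
  then show ?thesis by (simp add: diffquot_def abs_mult)
qed

lemma abs_dirderiv_AE_le:
  fixes u :: "'a::euclidean_space \<Rightarrow> real"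
  assumes u: "L-lipschitz_on UNIV u"
  shows "AE x in lborel. \<bar>dirderiv u v x\<bar> \<le> L * norm v"
  using dirderiv_AE[OF u, of v]
proof eventually_elim
  case (elim x)
  have "(\<lambda>k. \<bar>diffquot u v k x\<bar>) \<longlonglongrightarrow> \<bar>dirderiv u v x\<bar>"
    by (intro tendsto_rabs diffquot_tendsto elim)
  then show ?case by (rule LIMSEQ_le_const2) (use abs_diffquot_le[OF u] in blast)
qed

text \<open>Dominated convergence, with quotients bounded by the Lipschitz constant. The vanishing
  shifts \<open>a k\<close> of the test function are there to absorb the translation that arises
  when two directions are added.\<close>

lemma
  fixes u :: "'a::euclidean_space \<Rightarrow> real"
  assumes u: "L-lipschitz_on UNIV u" and \<psi>: "continuous_on UNIV \<psi>"
    and \<psi>1: "\<forall>x. \<bar>\<psi> x\<bar> \<le> 1" and supp: "\<forall>x. norm x > R \<longrightarrow> \<psi> x = 0"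
    and a: "a \<longlonglongrightarrow> 0"
  shows integrable_test_dirderiv: "integrable lborel (\<lambda>y. \<psi> y * dirderiv u v y)"
    and integrable_test_diffquot: "integrable lborel (\<lambda>y. \<psi> (y - a k) * diffquot u v k y)"
    and integral_test_diffquot_tendsto:
      "(\<lambda>k. LINT y|lborel. \<psi> (y - a k) * diffquot u v k y) \<longlonglongrightarrow> (LINT y|lborel. \<psi> y * dirderiv u v y)"
proof -
  have [measurable]: "u \<in> borel_measurable borel" "\<psi> \<in> borel_measurable borel"
    using u \<psi> by (auto intro: lipschitz_on_UNIV_borel_measurable borel_measurable_continuous_onI)
  \<comment> \<open>A common bound of the shifts puts all integrands into one ball, which gives the
    integrable majorant.\<close>
  obtain A where A: "\<And>k. norm (a k) \<le> A"
    using convergent_imp_Bseq[OF convergentI[OF a]] by (auto simp: Bseq_def)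
  let ?w = "\<lambda>y. indicator (cball 0 (R + A)) y * (L * norm v)"
  have dom: "norm (\<psi> (y - a k) * diffquot u v k y) \<le> ?w y" for y k
  proof (cases "norm y \<le> R + A")
    case True
    have "\<bar>\<psi> (y - a k)\<bar> * \<bar>diffquot u v k y\<bar> \<le> 1 * (L * norm v)"
      using \<psi>1 abs_diffquot_le[OF u] by (intro mult_mono) auto
    then show ?thesis using True by (simp add: abs_mult)
  next
    case False
    have "norm y \<le> norm (y - a k) + norm (a k)" by (metis diff_add_cancel norm_triangle_ineq)
    then have "norm (y - a k) > R" using False A[of k] by linarith
    then show ?thesis using False supp by simp
  qed
  have lim: "AE y in lborel. (\<lambda>k. \<psi> (y - a k) * diffquot u v k y) \<longlonglongrightarrow> \<psi> y * dirderiv u v y"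
    using dirderiv_AE[OF u, of v]
  proof eventually_elim
    case (elim y)
    have "(\<lambda>k. y - a k) \<longlonglongrightarrow> y - 0" by (intro tendsto_intros a)
    then have "(\<lambda>k. \<psi> (y - a k)) \<longlonglongrightarrow> \<psi> y"
      using continuous_on_tendsto_compose[OF \<psi>, of "\<lambda>k. y - a k" y] by simp
    then show ?case by (intro tendsto_mult diffquot_tendsto elim)
  qed
  have wi: "integrable lborel ?w"
    by (intro integrable_mult_left integrable_real_indicator emeasure_bounded_finite) auto
  note dc = _ _ wi lim AE_I2[OF dom]
  show "integrable lborel (\<lambda>y. \<psi> y * dirderiv u v y)"
    by (rule integrable_dominated_convergence[OF dc]) auto
  show "integrable lborel (\<lambda>y. \<psi> (y - a k) * diffquot u v k y)"
    by (rule integrable_dominated_convergence2[OF dc]) auto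
  show "(\<lambda>k. LINT y|lborel. \<psi> (y - a k) * diffquot u v k y) \<longlonglongrightarrow> (LINT y|lborel. \<psi> y * dirderiv u v y)"
    by (rule integral_dominated_convergence[OF dc]) auto
qed

section \<open>Additivity of the derivative in the direction, first tested, then pointwise\<close>

lemma integral_lborel_translate:
  fixes f :: "'a::euclidean_space \<Rightarrow> real"
  assumes [measurable]: "f \<in> borel_measurable borel"
  shows "(LINT x|lborel. f (c + x)) = (LINT x|lborel. f x)"
proof -
  have "(LINT x|lborel. f x) = (LINT x|distr lborel borel ((+) c). f x)"
    by (simp add: lborel_distr_plus)
  also have "\<dots> = (LINT x|lborel. f (c + x))" by (rule integral_distr) auto
  finally show ?thesis by simp
qed

text \<open>The quotient in direction \<open>v + w\<close> splits into one at \<open>y\<close> and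
  one at the moving point \<open>y + h k\<close>, which cannot be compared pointwise. Under the
  integral a translation moves \<open>h k\<close> onto the continuous test function, where it
  disappears in the limit.\<close>

lemma integral_test_dirderiv_add:
  fixes u :: "'a::euclidean_space \<Rightarrow> real"
  assumes u: "L-lipschitz_on UNIV u" and \<psi>: "continuous_on UNIV \<psi>"
    and \<psi>1: "\<forall>x. \<bar>\<psi> x\<bar> \<le> 1" and supp: "\<forall>x. norm x > R \<longrightarrow> \<psi> x = 0"
  shows "(LINT y|lborel. \<psi> y * dirderiv u (v + w) y)
       = (LINT y|lborel. \<psi> y * dirderiv u v y) + (LINT y|lborel. \<psi> y * dirderiv u w y)"
proof -
  have [measurable]: "u \<in> borel_measurable borel" "\<psi> \<in> borel_measurable borel"
    using u \<psi> by (auto intro: lipschitz_on_UNIV_borel_measurable borel_measurable_continuous_onI)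
  define h where "h = (\<lambda>k. (1 / real (Suc k)) *\<^sub>R v)"
  have "(\<lambda>k. 1 / real (Suc k)) \<longlonglongrightarrow> 0" using LIMSEQ_inverse_real_of_nat by (simp add: inverse_eq_divide)
  then have "h \<longlonglongrightarrow> 0 *\<^sub>R v" unfolding h_def by (intro tendsto_intros)
  then have h: "h \<longlonglongrightarrow> 0" by simp
  have z: "(\<lambda>k::nat. 0::'a) \<longlonglongrightarrow> 0" by simp
  note T = integral_test_diffquot_tendsto[OF u \<psi> \<psi>1 supp]
  note I = integrable_test_diffquot[OF u \<psi> \<psi>1 supp]
  have "(LINT y|lborel. \<psi> y * diffquot u (v + w) k y)
     = (LINT y|lborel. \<psi> y * diffquot u v k y) + (LINT y|lborel. \<psi> (y - h k) * diffquot u w k y)" for k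
  proof -
    have split: "diffquot u (v + w) k y = diffquot u v k y + diffquot u w k (h k + y)" for y
      unfolding diffquot_def h_def
      by (simp add: scaleR_add_right algebra_simps)
    have i1: "integrable lborel (\<lambda>y. \<psi> y * diffquot u v k y)" using I[OF z, of v k] by simp
    have i0: "integrable lborel (\<lambda>y. \<psi> y * diffquot u (v + w) k y)" using I[OF z, of "v + w" k] by simp
    have i2: "integrable lborel (\<lambda>y. \<psi> y * diffquot u w k (h k + y))"
      using Bochner_Integration.integrable_diff[OF i0 i1] by (simp add: split algebra_simps)
    have "(LINT y|lborel. \<psi> y * diffquot u (v + w) k y)
      = (LINT y|lborel. \<psi> y * diffquot u v k y) + (LINT y|lborel. \<psi> y * diffquot u w k (h k + y))"
      using Bochner_Integration.integral_add[OF i1 i2] by (simp add: split algebra_simps)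
    also have "(LINT y|lborel. \<psi> y * diffquot u w k (h k + y)) = (LINT y|lborel. \<psi> (y - h k) * diffquot u w k y)"
      using integral_lborel_translate[of "\<lambda>y. \<psi> (y - h k) * diffquot u w k y" "h k"] by simp
    finally show ?thesis .
  qed
  moreover have "(\<lambda>k. LINT y|lborel. \<psi> y * diffquot u (v + w) k y) \<longlonglongrightarrow> (LINT y|lborel. \<psi> y * dirderiv u (v + w) y)"
    using T[OF z, of "v + w"] by simp
  moreover have "(\<lambda>k. LINT y|lborel. \<psi> y * diffquot u v k y) \<longlonglongrightarrow> (LINT y|lborel. \<psi> y * dirderiv u v y)"
    using T[OF z, of v] by simp
  ultimately show ?thesis
    using T[OF h, of w] by (auto intro: LIMSEQ_unique tendsto_add)
qed

text \<open>Inner regularity fills the bounded part of \<open>{x. g x > 0}\<close> with a closed,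
  hence compact, set up to \<open>e\<close>. There \<open>g\<close> is positive with integral 0, so
  this set is null.\<close>

lemma AE_nonpos_of_integral_compact:
  fixes g :: "'a::euclidean_space \<Rightarrow> real"
  assumes [measurable]: "g \<in> borel_measurable borel"
    and int: "\<And>K. compact K \<Longrightarrow> integrable lborel (\<lambda>x. indicator K x * g x)"
    and zero: "\<And>K. compact K \<Longrightarrow> (LINT x|lborel. indicator K x * g x) = 0"
  shows "AE x in lborel. g x \<le> 0"
proof -
  define S where "S = (\<lambda>n::nat. {x. g x > 0} \<inter> cball 0 (real n))"
  have "{x \<in> space borel. 0 < g x} \<in> sets borel" by measurable
  then have [measurable]: "S n \<in> sets borel" for n unfolding S_def by (intro sets.Int) auto
  then have Sl: "S n \<in> sets lebesgue" for n by simp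
  have "S n \<in> null_sets lborel" for n
  proof -
    have *: "emeasure lebesgue (S n) \<le> 0 + ennreal e" if "e > 0" for e
    proof -
      obtain T where T: "closed T" "T \<subseteq> S n" "emeasure lebesgue (S n - T) < ennreal e"
        using sets_lebesgue_inner_closed[OF Sl \<open>e > 0\<close>] by metis
      have "compact T"
        using T bounded_subset[OF bounded_cball[of 0 "real n"]] by (auto simp: compact_eq_bounded_closed S_def)
      then have [measurable]: "T \<in> sets borel" by (simp add: borel_compact)
      have pos: "g x > 0" if "x \<in> T" for x using that T by (auto simp: S_def)
      have "AE x in lborel. indicator T x * g x = 0"
        using zero[OF \<open>compact T\<close>] int[OF \<open>compact T\<close>] pos
        by (subst integral_nonneg_eq_0_iff_AE[symmetric])
           (auto simp: indicator_def less_imp_le)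
      then have "AE x in lborel. x \<notin> T" by eventually_elim (use pos in \<open>force simp: indicator_def\<close>)
      then have "T \<in> null_sets lborel" by (subst AE_iff_null_sets) auto
      then have T0: "emeasure lebesgue T = 0" by (simp add: null_sets_def emeasure_completion)
      have "emeasure lebesgue (S n) \<le> emeasure lebesgue (T \<union> (S n - T))" 
        by (rule emeasure_mono) (auto simp: sets_completionI_sets)
      also have "\<dots> \<le> emeasure lebesgue T + emeasure lebesgue (S n - T)"
        by (rule emeasure_subadditive) auto
      finally show ?thesis using T(3) T0 by (auto intro: order_trans less_imp_le)
    qed
    have "emeasure lebesgue (S n) \<le> 0" by (rule ennreal_le_epsilon) (rule *)
    then show ?thesis by (simp add: null_sets_def emeasure_completion)
  qed
  then have "(\<Union>n. S n) \<in> null_sets lborel" by (intro null_sets_UN)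
  then show ?thesis
  proof (rule AE_I')
    show "{x \<in> space lborel. \<not> g x \<le> 0} \<subseteq> (\<Union>n. S n)"
      by (auto simp: S_def not_le real_arch_simple)
  qed
qed

text \<open>The defect of additivity integrates to 0 against continuous cutoffs, hence over every
  compact set by approximating its indicator. Applied to the defect and to its negative, the
  previous lemma gives both inequalities.\<close>

lemma dirderiv_add_AE:
  fixes u :: "'a::euclidean_space \<Rightarrow> real"
  assumes u: "L-lipschitz_on UNIV u"
  shows "AE x in lborel. dirderiv u (v + w) x = dirderiv u v x + dirderiv u w x"
proof -
  have [measurable]: "u \<in> borel_measurable borel"
    using u by (auto intro: lipschitz_on_UNIV_borel_measurable)
  define g where "g = (\<lambda>x. dirderiv u (v + w) x - dirderiv u v x - dirderiv u w x)"
  have [measurable]: "g \<in> borel_measurable borel" unfolding g_def by measurable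
  define B where "B = L * norm (v + w) + L * norm v + L * norm w"
  have gB: "AE x in lborel. \<bar>g x\<bar> \<le> B"
    using abs_dirderiv_AE_le[OF u, of "v + w"] abs_dirderiv_AE_le[OF u, of v] abs_dirderiv_AE_le[OF u, of w]
    by eventually_elim (auto simp: g_def B_def)
  have K: "integrable lborel (\<lambda>x. indicator K x * g x)" "(LINT x|lborel. indicator K x * g x) = 0" 
    if "compact K" for K
  proof -
    have [measurable]: "K \<in> sets borel" using that by (simp add: borel_compact)
    have "bounded K" using that by (rule compact_imp_bounded)
    then obtain R where R: "\<forall>x\<in>K. norm x \<le> R" by (meson bounded_iff)
    \<comment> \<open>The cutoff is 1 on \<open>K\<close> and, for \<open>m > 0\<close>, vanishes at
      distance \<open>1 / m\<close> from it. The empty set is separate because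
      \<open>infdist\<close> to it is 0, which would give the constant 1.\<close>
    define \<psi> where "\<psi> = (\<lambda>m x. if K = {} then 0 else max 0 (1 - real m * infdist x K))"
    have c\<psi>: "continuous_on UNIV (\<psi> m)" for m
      unfolding \<psi>_def by (cases "K = {}") (auto intro!: continuous_intros)
    then have [measurable]: "\<psi> m \<in> borel_measurable borel" for m
      by (rule borel_measurable_continuous_onI)
    have \<psi>1: "\<forall>x. \<bar>\<psi> m x\<bar> \<le> 1" for m
      by (auto simp: \<psi>_def infdist_nonneg)
    \<comment> \<open>The index starts at \<open>Suc 0\<close>: for index 0 the cutoff of a nonempty
      \<open>K\<close> is constantly 1, without bounded support.\<close>
    have supp0: "\<psi> (Suc m) x = 0" if "norm x > R + 1" for m x
    proof (cases "K = {}")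
      case False
      then obtain y where y: "y \<in> K" "infdist x K = dist x y"
        using infdist_attains_inf[OF compact_imp_closed[OF \<open>compact K\<close>]] by metis
      have "norm y \<le> R" using y R by auto
      then have "1 \<le> dist x y" using that norm_triangle_sub[of x y] by (simp add: dist_norm)
      then have "1 * 1 \<le> real (Suc m) * infdist x K" using y by (intro mult_mono) auto
      then show ?thesis by (simp add: \<psi>_def)
    qed (simp add: \<psi>_def)
    have supp: "\<forall>x. norm x > R + 1 \<longrightarrow> \<psi> (Suc m) x = 0" for m using supp0 by blast
    have zero: "(LINT x|lborel. \<psi> (Suc m) x * g x) = 0" for m
    proof -
      note I = integrable_test_dirderiv[OF u c\<psi> \<psi>1 supp tendsto_const]
      have "\<psi> (Suc m) x * g x = \<psi> (Suc m) x * dirderiv u (v + w) x - \<psi> (Suc m) x * dirderiv u v x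
         - \<psi> (Suc m) x * dirderiv u w x" for x by (simp add: g_def algebra_simps)
      then show ?thesis
        using integral_test_dirderiv_add[OF u c\<psi> \<psi>1 supp, of m v w] I by simp
    qed
    have lim: "(\<lambda>m. \<psi> (Suc m) x) \<longlonglongrightarrow> indicator K x" for x
    proof (cases "x \<in> K")
      case True
      then have "\<psi> (Suc m) x = 1" for m by (auto simp: \<psi>_def)
      then show ?thesis using True by simp
    next
      case False
      show ?thesis
      proof (cases "K = {}")
        case ne: False
        have pos: "infdist x K > 0"
          using False ne compact_imp_closed[OF that] by (metis infdist_nonneg in_closed_iff_infdist_zero less_eq_real_def)
        obtain N where N: "1 / infdist x K < real N" using reals_Archimedean2 by blast
        have "\<psi> (Suc m) x = 0" if "m \<ge> N" for m
        proof -
          have "1 / infdist x K < real (Suc m)" using N that by linarith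
          then have "1 < real (Suc m) * infdist x K" using pos by (simp add: divide_less_eq)
          then show ?thesis by (simp add: \<psi>_def)
        qed
        then show ?thesis using False
          by (intro tendsto_eventually) (auto simp: eventually_sequentially)
      qed (simp add: \<psi>_def)
    qed
    let ?w = "\<lambda>y::'a. indicator (cball 0 (R + 1)) y * B"
    have wi: "integrable lborel ?w"
      by (intro integrable_mult_left integrable_real_indicator emeasure_bounded_finite) auto
    have lim': "AE x in lborel. (\<lambda>m. \<psi> (Suc m) x * g x) \<longlonglongrightarrow> indicator K x * g x"
      by (intro AE_I2 tendsto_mult lim tendsto_const)
    have dom: "AE x in lborel. norm (\<psi> (Suc m) x * g x) \<le> ?w x" for m
      using gB
    proof eventually_elim
      case (elim x)
      show ?case
      proof (cases "norm x \<le> R + 1")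
        case True
        have "\<bar>\<psi> (Suc m) x\<bar> * \<bar>g x\<bar> \<le> 1 * B" using elim \<psi>1 by (intro mult_mono) auto
        then show ?thesis using True by (simp add: abs_mult)
      qed (simp add: supp)
    qed
    show "integrable lborel (\<lambda>x. indicator K x * g x)"
      by (rule integrable_dominated_convergence[OF _ _ wi lim' dom]) auto
    have "(\<lambda>m. LINT x|lborel. \<psi> (Suc m) x * g x) \<longlonglongrightarrow> (LINT x|lborel. indicator K x * g x)"
      by (rule integral_dominated_convergence[OF _ _ wi lim' dom]) auto
    then show "(LINT x|lborel. indicator K x * g x) = 0"
      unfolding zero using LIMSEQ_unique tendsto_const by blast
  qed
  have "AE x in lborel. g x \<le> 0"
    by (rule AE_nonpos_of_integral_compact) (use K in auto)
  moreover have "AE x in lborel. - g x \<le> 0"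
    by (rule AE_nonpos_of_integral_compact) (use K in auto)
  ultimately show ?thesis by eventually_elim (auto simp: g_def)
qed

section \<open>From directional derivatives to the total derivative\<close>

lemma quotient_scaleR_tendsto:
  fixes u :: "'a::real_normed_vector \<Rightarrow> real"
  assumes "((\<lambda>t. (u (x + t *\<^sub>R v) - u x) / t) \<longlongrightarrow> l) (at (0::real))"
  shows "((\<lambda>t. (u (x + t *\<^sub>R (c *\<^sub>R v)) - u x) / t) \<longlongrightarrow> c * l) (at 0)"
proof (cases "c = 0")
  case False
  have "((\<lambda>t. t * c) \<longlongrightarrow> 0 * c) (at 0)" by (intro tendsto_intros)
  then have "filterlim (\<lambda>t. t * c) (at 0) (at 0)"
    using False by (auto simp: filterlim_at eventually_at_filter)
  from filterlim_compose[OF assms this]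
  have "((\<lambda>t. c * ((u (x + (t * c) *\<^sub>R v) - u x) / (t * c))) \<longlongrightarrow> c * l) (at 0)"
    by (intro tendsto_mult tendsto_const)
  then show ?thesis using False by simp
qed simp

text \<open>The null set depends on the coefficients \<open>c\<close>, so the relation can be used
  for countably many directions at once, but not for all.\<close>

lemma dirderiv_sum_AE:
  fixes u :: "'a::euclidean_space \<Rightarrow> real"
  assumes u: "L-lipschitz_on UNIV u" and "finite B"
  shows "AE x in lborel. dirderiv u (\<Sum>b\<in>B. c b *\<^sub>R b) x = (\<Sum>b\<in>B. c b * dirderiv u b x)"
  using \<open>finite B\<close>
proof induction
  case empty
  have "dirderiv u 0 x = 0" for x by (rule dirderiv_eqI) simp
  then show ?case by simp
next
  case (insert b B)
  from insert.IH dirderiv_add_AE[OF u, of "c b *\<^sub>R b" "\<Sum>b\<in>B. c b *\<^sub>R b"] dirderiv_AE[OF u, of b]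
  show ?case
  proof eventually_elim
    case (elim x)
    have "dirderiv u (c b *\<^sub>R b) x = c b * dirderiv u b x"
      by (rule dirderiv_eqI[OF quotient_scaleR_tendsto[OF elim(3)]])
    then show ?case using elim insert.hyps by simp
  qed
qed

text \<open>By compactness finitely many directions of \<open>Q\<close> come close to every unit
  vector, so convergence is uniform over them; the Lipschitz bound carries it to all
  directions.\<close>

lemma lipschitz_has_derivative_of_dense_directions:
  fixes u :: "'a::euclidean_space \<Rightarrow> real"
  assumes u: "L-lipschitz_on UNIV u"
    and dense: "\<And>X. open X \<Longrightarrow> X \<noteq> {} \<Longrightarrow> \<exists>d\<in>Q. d \<in> X"
    and lim: "\<And>v. v \<in> Q \<Longrightarrow> ((\<lambda>t. (u (x + t *\<^sub>R v) - u x) / t) \<longlongrightarrow> g \<bullet> v) (at 0)"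
  shows "(u has_derivative (\<lambda>h. g \<bullet> h)) (at x)"
  unfolding has_derivative_at_alt
proof (intro conjI allI impI)
  show "bounded_linear ((\<bullet>) g)" by (rule bounded_linear_inner_right)
  fix e :: real assume "e > 0"
  have L: "0 \<le> L" by (rule lipschitz_on_nonneg[OF u])
  \<comment> \<open>The denominator collects three errors: 1 for the quotient in a chosen direction
    \<open>q\<close>, \<open>L\<close> for replacing the true direction by \<open>q\<close> in
    \<open>u\<close>, and \<open>norm g\<close> for the same replacement in the linear part.\<close>
  define \<epsilon> where "\<epsilon> = e / (1 + L + norm g)"
  have den: "1 + L + norm g > 0" using L norm_ge_zero[of g] by linarith
  have \<epsilon>: "\<epsilon> > 0" "\<epsilon> * (1 + L + norm g) = e" using \<open>e > 0\<close> den by (auto simp: \<epsilon>_def)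
  have "sphere 0 1 \<subseteq> (\<Union>q\<in>Q. ball q \<epsilon>)"
  proof
    fix \<theta> :: 'a
    obtain q where "q \<in> Q" "q \<in> ball \<theta> \<epsilon>" using dense[of "ball \<theta> \<epsilon>"] \<epsilon> by auto
    then show "\<theta> \<in> (\<Union>q\<in>Q. ball q \<epsilon>)" by (auto simp: dist_commute)
  qed
  then obtain C where C: "C \<subseteq> Q" "finite C" "sphere 0 1 \<subseteq> (\<Union>q\<in>C. ball q \<epsilon>)"
    using compactE_image[OF compact_sphere[of "0::'a" 1], of Q "\<lambda>q. ball q \<epsilon>"] by auto
  have "\<forall>q\<in>C. \<forall>\<^sub>F t in at 0. dist ((u (x + t *\<^sub>R q) - u x) / t) (g \<bullet> q) < \<epsilon>"
    using tendstoD[OF lim \<epsilon>(1)] C(1) by auto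
  then have "\<forall>\<^sub>F t in at 0. \<forall>q\<in>C. dist ((u (x + t *\<^sub>R q) - u x) / t) (g \<bullet> q) < \<epsilon>"
    using C(2) by (simp add: eventually_ball_finite)
  then obtain d where d: "d > 0"
    "\<And>t q. t \<noteq> 0 \<Longrightarrow> \<bar>t\<bar> < d \<Longrightarrow> q \<in> C \<Longrightarrow> \<bar>(u (x + t *\<^sub>R q) - u x) / t - g \<bullet> q\<bar> < \<epsilon>"
    unfolding eventually_at by (auto simp: dist_real_def)
  show "\<exists>d>0. \<forall>y. norm (y - x) < d \<longrightarrow> norm (u y - u x - g \<bullet> (y - x)) \<le> e * norm (y - x)"
  proof (intro exI conjI allI impI)
    show "d > 0" by fact
    fix y assume y: "norm (y - x) < d"
    show "norm (u y - u x - g \<bullet> (y - x)) \<le> e * norm (y - x)"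
    proof (cases "y = x")
      case False
      define t where "t = norm (y - x)"
      define \<theta> where "\<theta> = (y - x) /\<^sub>R t"
      have t: "t > 0" "\<bar>t\<bar> < d" using False y by (auto simp: t_def)
      have y_eq: "y = x + t *\<^sub>R \<theta>" using t by (simp add: \<theta>_def)
      have "norm \<theta> = 1" using False by (simp add: \<theta>_def t_def)
      then obtain q where q: "q \<in> C" "dist q \<theta> < \<epsilon>" using C(3) by auto
      have q': "norm (\<theta> - q) \<le> \<epsilon>" using q by (simp add: dist_norm norm_minus_commute)
      have "\<bar>(u (x + t *\<^sub>R q) - u x) / t - g \<bullet> q\<bar> < \<epsilon>" using d(2) t q by auto
      then have "\<bar>(u (x + t *\<^sub>R q) - u x) / t - g \<bullet> q\<bar> * t \<le> \<epsilon> * t" using t by (intro mult_right_mono) auto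
      moreover have "\<bar>(u (x + t *\<^sub>R q) - u x) / t - g \<bullet> q\<bar> * t = \<bar>((u (x + t *\<^sub>R q) - u x) / t - g \<bullet> q) * t\<bar>"
        using t by (simp add: abs_mult)
      moreover have "((u (x + t *\<^sub>R q) - u x) / t - g \<bullet> q) * t = u (x + t *\<^sub>R q) - u x - t * (g \<bullet> q)"
        using t by (simp add: field_simps)
      ultimately have 1: "\<bar>u (x + t *\<^sub>R q) - u x - t * (g \<bullet> q)\<bar> \<le> \<epsilon> * t" by simp
      have "\<bar>u (x + t *\<^sub>R \<theta>) - u (x + t *\<^sub>R q)\<bar> \<le> L * dist (x + t *\<^sub>R \<theta>) (x + t *\<^sub>R q)"
        using lipschitz_onD[OF u, of "x + t *\<^sub>R \<theta>" "x + t *\<^sub>R q"] by (simp add: dist_real_def)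
      also have "dist (x + t *\<^sub>R \<theta>) (x + t *\<^sub>R q) = t * norm (\<theta> - q)"
        using t by (simp add: dist_norm scaleR_diff_right[symmetric])
      also have "L * (t * norm (\<theta> - q)) \<le> L * (t * \<epsilon>)"
        using L t q' by (intro mult_left_mono) auto
      finally have 2: "\<bar>u (x + t *\<^sub>R \<theta>) - u (x + t *\<^sub>R q)\<bar> \<le> L * (t * \<epsilon>)" .
      have "\<bar>g \<bullet> (\<theta> - q)\<bar> \<le> norm g * \<epsilon>"
        using Cauchy_Schwarz_ineq2[of g "\<theta> - q"] mult_left_mono[OF q' norm_ge_zero[of g]] by linarith
      then have "t * \<bar>g \<bullet> (\<theta> - q)\<bar> \<le> t * (norm g * \<epsilon>)" using t by (intro mult_left_mono) auto
      then have 3: "\<bar>t * (g \<bullet> q) - t * (g \<bullet> \<theta>)\<bar> \<le> t * (norm g * \<epsilon>)"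
        using t by (simp add: inner_diff_right abs_mult[symmetric] right_diff_distrib[symmetric] abs_minus_commute)
          (simp add: abs_mult abs_minus_commute)
      have "\<bar>u y - u x - t * (g \<bullet> \<theta>)\<bar> \<le> \<epsilon> * t + L * (t * \<epsilon>) + t * (norm g * \<epsilon>)"
        using 1 2 3 unfolding y_eq by linarith
      also have "\<dots> = (\<epsilon> * (1 + L + norm g)) * t" by (simp add: algebra_simps)
      finally show ?thesis unfolding \<epsilon>(2) by (simp add: y_eq) (simp add: t_def y_eq[symmetric] \<open>norm \<theta> = 1\<close>)
    qed simp
  qed
qed

text \<open>Almost everywhere the derivatives in a countable dense set of directions exist and, by
  additivity, are given by the vector of partial derivatives; density of the directions then yields
  differentiability.\<close>

theorem rademacher:
  fixes u :: "'a::euclidean_space \<Rightarrow> real"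
  assumes u: "L-lipschitz_on UNIV u"
  shows "AE x in lborel. (u has_derivative (\<lambda>h. (\<Sum>b\<in>Basis. dirderiv u b x *\<^sub>R b) \<bullet> h)) (at x)"
proof -
  obtain Q :: "'a set" where Q: "countable Q" "\<And>X. open X \<Longrightarrow> X \<noteq> {} \<Longrightarrow> \<exists>d\<in>Q. d \<in> X"
    using countable_dense_exists by blast
  have "AE x in lborel. ((\<lambda>t. (u (x + t *\<^sub>R v) - u x) / t) \<longlongrightarrow>
      (\<Sum>b\<in>Basis. dirderiv u b x *\<^sub>R b) \<bullet> v) (at 0)" for v
    using dirderiv_AE[OF u, of v] dirderiv_sum_AE[OF u finite_Basis, of "\<lambda>b. v \<bullet> b"]
  proof eventually_elim
    case (elim x)
    have "(\<Sum>b\<in>Basis. dirderiv u b x *\<^sub>R b) \<bullet> v = (\<Sum>b\<in>Basis. (v \<bullet> b) * dirderiv u b x)"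
      unfolding inner_sum_left by (simp add: inner_commute mult.commute)
    then show ?case using elim by (simp add: euclidean_representation)
  qed
  then have "AE x in lborel. \<forall>v\<in>Q. ((\<lambda>t. (u (x + t *\<^sub>R v) - u x) / t) \<longlongrightarrow>
      (\<Sum>b\<in>Basis. dirderiv u b x *\<^sub>R b) \<bullet> v) (at 0)"
    using Q(1) by (simp add: AE_ball_countable)
  then show ?thesis
  proof eventually_elim
    case (elim x)
    then show ?case by (intro lipschitz_has_derivative_of_dense_directions[OF u Q(2)]) auto
  qed
qed

section \<open>Integrals of derivatives of compactly supported Lipschitz functions\<close>

lemma has_derivative_imp_quotient_tendsto:
  assumes "(u has_derivative u') (at x)"
  shows "((\<lambda>t. (u (x + t *\<^sub>R v) - u x) / t) \<longlongrightarrow> u' v) (at (0::real))"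
proof -
  have "((\<lambda>t::real. x + t *\<^sub>R v) has_derivative (\<lambda>t. t *\<^sub>R v)) (at 0)"
    by (auto intro!: derivative_eq_intros)
  then have "((\<lambda>t. u (x + t *\<^sub>R v)) has_derivative (\<lambda>t. u' (t *\<^sub>R v))) (at 0)"
    using has_derivative_compose[of "\<lambda>t. x + t *\<^sub>R v" _ 0 UNIV u u'] assms by simp
  moreover have "(\<lambda>t. u' (t *\<^sub>R v)) = (*) (u' v)"
    by (simp add: fun_eq_iff linear_cmul[OF has_derivative_linear[OF assms]])
  ultimately have "((\<lambda>t. u (x + t *\<^sub>R v)) has_real_derivative u' v) (at 0)"
    by (simp add: has_field_derivative_def)
  then show ?thesis
    by (simp add: has_field_derivative_iff)
qed

lemma has_derivative_imp_dirderiv: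
  "(u has_derivative u') (at x) \<Longrightarrow> dirderiv u v x = u' v"
  by (intro dirderiv_eqI has_derivative_imp_quotient_tendsto)

text \<open>Every difference quotient has integral 0 by translation invariance, and this survives
  the limit. Applied to products, it becomes integration by parts.\<close>

lemma
  fixes W :: "'a::euclidean_space \<Rightarrow> real"
  assumes W: "L-lipschitz_on UNIV W" and supp: "\<And>x. norm x > R \<Longrightarrow> W x = 0"
  shows integral_dirderiv_eq_0: "(LINT x|lborel. dirderiv W v x) = 0"
    and integrable_dirderiv: "integrable lborel (dirderiv W v)"
proof -
  have cW: "continuous_on UNIV W" using W by (rule lipschitz_on_continuous_on)
  have [measurable]: "W \<in> borel_measurable borel" using W by (rule lipschitz_on_UNIV_borel_measurable)
  \<comment> \<open>Steps have length at most \<open>norm v\<close>, so all quotients vanish beyond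
    \<open>R + norm v\<close>, and up to there the cutoff is 1. Multiplying by it changes
    nothing.\<close>
  define \<psi> where "\<psi> = (\<lambda>x::'a. max 0 (min 1 (R + norm v + 1 - norm x)))"
  have \<psi>: "continuous_on UNIV \<psi>" unfolding \<psi>_def by (intro continuous_intros)
  have \<psi>1: "\<forall>x. \<bar>\<psi> x\<bar> \<le> 1" by (auto simp: \<psi>_def)
  have \<psi>2: "\<forall>x. norm x > R + norm v + 1 \<longrightarrow> \<psi> x = 0" by (auto simp: \<psi>_def)
  have dq0: "diffquot W v k x = 0" if "norm x > R + norm v" for k x
  proof -
    let ?h = "(1 / real (Suc k)) *\<^sub>R v"
    have "(1 / real (Suc k)) * norm v \<le> 1 * norm v" by (intro mult_right_mono) auto
    then have "norm ?h \<le> norm v" by simp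
    moreover have "norm x \<le> norm (x + ?h) + norm ?h" by (metis add_diff_cancel_right' norm_triangle_ineq4)
    ultimately have "norm (x + ?h) > R" using that by linarith
    moreover have "norm x > R" using that norm_ge_zero[of v] by linarith
    ultimately show ?thesis using supp by (simp add: diffquot_def)
  qed
  have \<psi>dq: "\<psi> x * diffquot W v k x = diffquot W v k x" for k x
    using dq0[of x k] by (cases "norm x > R + norm v") (auto simp: \<psi>_def)
  have \<psi>dd: "\<psi> x * dirderiv W v x = dirderiv W v x" for x
  proof (cases "norm x > R + norm v")
    case True
    then have "dirderiv W v x = 0" using dq0[of x] by (simp add: dirderiv_def)
    then show ?thesis by simp
  qed (auto simp: \<psi>_def)
  have z: "(\<lambda>k::nat. 0::'a) \<longlonglongrightarrow> 0" by simp
  show "integrable lborel (dirderiv W v)"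
    using integrable_test_dirderiv[OF W \<psi> \<psi>1 \<psi>2 z, of v] by (simp add: \<psi>dd)
  have "integrable lborel (\<lambda>x. indicator (cball 0 R) x *\<^sub>R W x)"
    by (rule borel_integrable_compact) (auto intro: continuous_on_subset[OF cW])
  moreover have "(\<lambda>x. indicator (cball 0 R) x *\<^sub>R W x) = W"
    using supp by (auto simp: indicator_def fun_eq_iff not_le)
  ultimately have Wi: "integrable lborel W" by simp
  have "(LINT x|lborel. diffquot W v k x) = 0" for k
  proof -
    let ?h = "(1 / real (Suc k)) *\<^sub>R v"
    have "integrable (distr lborel borel ((+) ?h)) W" using Wi by (simp add: lborel_distr_plus)
    then have "integrable lborel (\<lambda>x. W (?h + x))" by (subst (asm) integrable_distr_eq) auto
    then have "integrable lborel (\<lambda>x. W (x + ?h))" by (simp add: add.commute)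
    then have "(LINT x|lborel. diffquot W v k x) = real (Suc k) * ((LINT x|lborel. W (x + ?h)) - (LINT x|lborel. W x))"
      unfolding diffquot_def using Wi by simp
    also have "(LINT x|lborel. W (x + ?h)) = (LINT x|lborel. W x)"
      using integral_lborel_translate[of W ?h] by (simp add: add.commute)
    finally show ?thesis by simp
  qed
  then have "(\<lambda>k::nat. 0) \<longlonglongrightarrow> (LINT x|lborel. dirderiv W v x)"
    using integral_test_diffquot_tendsto[OF W \<psi> \<psi>1 \<psi>2 z, of v] by (simp add: \<psi>dd \<psi>dq)
  then show "(LINT x|lborel. dirderiv W v x) = 0" using LIMSEQ_unique tendsto_const by blast
qed

section \<open>Gradients of Lipschitz functions and the energy\<close>

lemma grad_eqI:
  assumes "(v has_derivative (\<lambda>h. g \<bullet> h)) (at x)"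
  shows "grad v x = g"
proof -
  have "g' = g" if "(v has_derivative (\<lambda>h. g' \<bullet> h)) (at x)" for g'
  proof -
    have "(\<lambda>h. g' \<bullet> h) = (\<lambda>h. g \<bullet> h)" by (rule has_derivative_unique[OF that assms])
    then have "g' \<bullet> (g' - g) = g \<bullet> (g' - g)" by metis
    then have "(g' - g) \<bullet> (g' - g) = 0" by (simp add: inner_diff_left)
    then show ?thesis by simp
  qed
  then have "(SOME g. (v has_derivative (\<lambda>h. g \<bullet> h)) (at x)) = g"
    using some_equality[of "\<lambda>g. (v has_derivative (\<lambda>h. g \<bullet> h)) (at x)" g, OF assms] by simp
  moreover have "\<exists>g. (v has_derivative (\<lambda>h. g \<bullet> h)) (at x)" using assms by blast
  ultimately show ?thesis by (simp add: grad_def)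
qed

lemma grad_has_derivative:
  assumes "(v has_derivative (\<lambda>h. g \<bullet> h)) (at x)"
  shows "(v has_derivative (\<lambda>h. grad v x \<bullet> h)) (at x)"
  using assms grad_eqI[OF assms] by simp

lemma grad_AE:
  assumes "L-lipschitz_on UNIV v"
  shows "AE x in lebesgue. (v has_derivative (\<lambda>h. grad v x \<bullet> h)) (at x)"
  using AE_completion[OF rademacher[OF assms]] by eventually_elim (rule grad_has_derivative)

lemma grad_uminus: "grad (\<lambda>x. - v x) x = - grad v x"
proof (cases "\<exists>g. (v has_derivative (\<lambda>h. g \<bullet> h)) (at x)")
  case True
  then obtain g where g: "(v has_derivative (\<lambda>h. g \<bullet> h)) (at x)" by blast
  have "((\<lambda>x. - v x) has_derivative (\<lambda>h. (- g) \<bullet> h)) (at x)"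
    using has_derivative_minus[OF g] by simp
  then show ?thesis using grad_eqI[OF g] grad_eqI by blast
next
  case False
  have "\<not> (\<exists>g. ((\<lambda>x. - v x) has_derivative (\<lambda>h. g \<bullet> h)) (at x))"
  proof
    assume "\<exists>g. ((\<lambda>x. - v x) has_derivative (\<lambda>h. g \<bullet> h)) (at x)"
    then obtain g where "((\<lambda>x. - v x) has_derivative (\<lambda>h. g \<bullet> h)) (at x)" by blast
    then have "(v has_derivative (\<lambda>h. (- g) \<bullet> h)) (at x)"
      using has_derivative_minus[of "\<lambda>x. - v x"] by fastforce
    then show False using False by blast
  qed
  then show ?thesis using False by (simp add: grad_def)
qed

text \<open>The points of non-differentiability are only known to lie inside a Borel null set, so
  completeness of \<open>lebesgue\<close> makes them measurable. Elsewhere the gradient is the Borel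
  vector of partial derivatives.\<close>

lemma grad_measurable:
  fixes v :: "real^'n \<Rightarrow> real"
  assumes v: "L-lipschitz_on UNIV v"
  shows "grad v \<in> borel_measurable lebesgue"
proof -
  have [measurable]: "v \<in> borel_measurable borel"
    using v by (rule lipschitz_on_UNIV_borel_measurable)
  define D where "D = {x. \<exists>g. (v has_derivative (\<lambda>h. g \<bullet> h)) (at x)}"
  define G where "G = (\<lambda>x. \<Sum>b\<in>Basis. dirderiv v b x *\<^sub>R b)"
  have "G \<in> borel_measurable borel" unfolding G_def by measurable
  then have G: "G \<in> borel_measurable lebesgue" by (intro measurable_completion) simp
  have "AE x in lborel. x \<in> D" using rademacher[OF v] by eventually_elim (auto simp: D_def)
  then obtain N where "{x \<in> space lborel. x \<notin> D} \<subseteq> N" "emeasure lborel N = 0" "N \<in> sets lborel"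
    by (rule AE_E)
  then have "- D \<subseteq> N" "N \<in> null_sets lborel" by (auto simp: null_sets_def)
  then have "- D \<in> null_sets lebesgue"
    using null_sets_completion_subset null_sets_completionI by blast
  then have "- (- D) \<in> sets lebesgue" by (metis Compl_in_sets_lebesgue null_setsD2)
  then have "{x \<in> space lebesgue. x \<in> D} \<in> sets lebesgue" by simp
  then have "(\<lambda>x. if x \<in> D then G x else 0) \<in> borel_measurable lebesgue"
    by (intro measurable_If G) auto
  moreover have "(\<lambda>x. if x \<in> D then G x else 0) = grad v"
  proof
    fix x
    show "(if x \<in> D then G x else 0) = grad v x"
    proof (cases "x \<in> D")
      case True
      then obtain g where g: "(v has_derivative (\<lambda>h. g \<bullet> h)) (at x)" by (auto simp: D_def)
      have "G x = (\<Sum>b\<in>Basis. (g \<bullet> b) *\<^sub>R b)"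
        unfolding G_def using has_derivative_imp_dirderiv[OF g] by simp
      then show ?thesis using True grad_eqI[OF g] by (simp add: euclidean_representation)
    qed (simp add: D_def grad_def)
  qed
  ultimately show ?thesis by simp
qed

text \<open>Quotients in the direction of the gradient \<open>g\<close> give
  \<open>g \<bullet> g \<le> L * norm g\<close>. The default value 0 satisfies the bound as well, so
  it holds at every point.\<close>

lemma norm_grad_le:
  fixes v :: "real^'n \<Rightarrow> real"
  assumes v: "L-lipschitz_on UNIV v"
  shows "norm (grad v x) \<le> L"
proof (cases "\<exists>g. (v has_derivative (\<lambda>h. g \<bullet> h)) (at x)")
  case True
  then obtain g where g: "(v has_derivative (\<lambda>h. g \<bullet> h)) (at x)" by blast
  have "((\<lambda>t. (v (x + t *\<^sub>R g) - v x) / t) \<longlongrightarrow> g \<bullet> g) (at 0)"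
    by (rule has_derivative_imp_quotient_tendsto[OF g])
  then have "(\<lambda>k. \<bar>diffquot v g k x\<bar>) \<longlonglongrightarrow> \<bar>g \<bullet> g\<bar>"
    by (intro tendsto_rabs diffquot_tendsto)
  then have "\<bar>g \<bullet> g\<bar> \<le> L * norm g"
    by (rule LIMSEQ_le_const2) (use abs_diffquot_le[OF v] in blast)
  then have "norm g * norm g \<le> L * norm g" by (simp add: dot_square_norm power2_eq_square)
  then have "norm g \<le> L" using lipschitz_on_nonneg[OF v] by (cases "g = 0") auto
  then show ?thesis using grad_eqI[OF g] by simp
qed (use lipschitz_on_nonneg[OF v] in \<open>simp add: grad_def\<close>)

text \<open>Gradients stay in a compact ball, where the continuous \<Phi> is bounded. The factor
  \<open>c\<close> lets one energy serve both \<open>u\<close> and \<open>-u\<close>.\<close>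

lemma integrable_energy:
  fixes v :: "real^'n \<Rightarrow> real" and \<Phi> :: "real^'n \<Rightarrow> real"
  assumes v: "L-lipschitz_on UNIV v" and \<Omega>: "open \<Omega>" "bounded \<Omega>" and \<Phi>: "continuous_on UNIV \<Phi>"
  shows "integrable lebesgue (\<lambda>x. indicator \<Omega> x *\<^sub>R (\<Phi> (grad v x) - c * v x))"
proof -
  have cv: "continuous_on UNIV v" using v by (rule lipschitz_on_continuous_on)
  have "\<Phi> \<in> borel_measurable borel" using \<Phi> by (rule borel_measurable_continuous_onI)
  then have m1: "(\<lambda>x. \<Phi> (grad v x)) \<in> borel_measurable lebesgue"
    by (rule measurable_compose[OF grad_measurable[OF v]])
  have "v \<in> borel_measurable borel" using v by (rule lipschitz_on_UNIV_borel_measurable)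
  then have m2: "v \<in> borel_measurable lebesgue" by (intro measurable_completion) simp
  have "compact (\<Phi> ` cball 0 L)"
    by (intro compact_continuous_image continuous_on_subset[OF \<Phi>]) auto
  then obtain B1 where B1: "\<And>p. norm p \<le> L \<Longrightarrow> \<bar>\<Phi> p\<bar> \<le> B1"
    using compact_imp_bounded bounded_iff by (metis imageI mem_cball_0 real_norm_def)
  have "compact (v ` closure \<Omega>)"
    using \<Omega> by (intro compact_continuous_image continuous_on_subset[OF cv]) (auto simp: compact_closure)
  then obtain B2 where B2: "\<And>x. x \<in> closure \<Omega> \<Longrightarrow> \<bar>v x\<bar> \<le> B2"
    using compact_imp_bounded bounded_iff by (metis imageI real_norm_def)
  show ?thesis
  proof (rule integrableI_bounded_set_indicator)
    show "\<Omega> \<in> sets lebesgue" using \<Omega> by (simp add: borel_open)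
    show "(\<lambda>x. \<Phi> (grad v x) - c * v x) \<in> borel_measurable lebesgue" using m1 m2 by measurable
    show "emeasure lebesgue \<Omega> < \<infinity>"
      using \<Omega>(1) emeasure_bounded_finite[OF \<Omega>(2)] by (simp add: borel_open)
    show "AE x in lebesgue. x \<in> \<Omega> \<longrightarrow> norm (\<Phi> (grad v x) - c * v x) \<le> B1 + \<bar>c\<bar> * B2"
    proof (intro AE_I2 impI)
      fix x assume "x \<in> \<Omega>"
      then have "\<bar>v x\<bar> \<le> B2" using B2 closure_subset by blast
      then have "\<bar>c * v x\<bar> \<le> \<bar>c\<bar> * B2" by (simp add: abs_mult mult_left_mono)
      then show "norm (\<Phi> (grad v x) - c * v x) \<le> B1 + \<bar>c\<bar> * B2"
        using B1[OF norm_grad_le[OF v, of x]] by simp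
    qed
  qed
qed

section \<open>Lipschitz functions on balls: extension and products\<close>

lemma lipschitz_on_derivative_bound:
  assumes "convex S" and d: "\<And>x. x \<in> S \<Longrightarrow> (f has_derivative f' x) (at x)"
    and B: "\<And>x h. x \<in> S \<Longrightarrow> norm (f' x h) \<le> B * norm h" and "0 \<le> B"
  shows "B-lipschitz_on S f"
proof (rule lipschitz_onI)
  fix x y assume "x \<in> S" "y \<in> S"
  then have "norm (f x - f y) \<le> B * norm (x - y)"
    using assms by (intro differentiable_bound[of S f f'])
      (auto intro: has_derivative_at_withinI onorm_bound)
  then show "dist (f x) (f y) \<le> B * dist x y" by (simp add: dist_norm)
qed fact

text \<open>The only critical pair has \<open>x\<close> inside and \<open>y\<close> outside the
  ball: then either \<open>g x = 0\<close>, or the points are at least \<open>r / 2\<close> apart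
  and boundedness of \<open>g\<close> suffices.\<close>

lemma lipschitz_on_extend_zero:
  fixes g :: "'a::real_normed_vector \<Rightarrow> real"
  assumes g: "K-lipschitz_on (ball x0 r) g" and r: "r > 0"
    and z: "\<And>x. x \<in> ball x0 r \<Longrightarrow> r / 2 \<le> dist x0 x \<Longrightarrow> g x = 0"
  shows "\<exists>K'. K'-lipschitz_on UNIV (\<lambda>x. if x \<in> ball x0 r then g x else 0)"
proof -
  let ?w = "\<lambda>x. if x \<in> ball x0 r then g x else 0"
  have K: "0 \<le> K" by (rule lipschitz_on_nonneg[OF g])
  define C where "C = \<bar>g x0\<bar> + K * r"
  have C0: "0 \<le> C" using K r by (simp add: C_def)
  have C: "\<bar>g x\<bar> \<le> C" if "x \<in> ball x0 r" for x
  proof -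
    have "\<bar>g x - g x0\<bar> \<le> K * dist x x0"
      using lipschitz_onD[OF g that, of x0] r by (simp add: dist_real_def)
    also have "\<dots> \<le> K * r" using that K by (intro mult_left_mono) (auto simp: dist_commute)
    finally show ?thesis by (simp add: C_def)
  qed
  \<comment> \<open>The slope \<open>2 * C / r\<close> is what a drop from \<open>C\<close> to 0
    over the distance \<open>r / 2\<close> requires.\<close>
  define K' where "K' = K + 2 * C / r"
  have KK: "K \<le> K'" "2 * C / r \<le> K'" "0 \<le> K'" using K C0 r by (auto simp: K'_def)
  have out: "\<bar>g x\<bar> \<le> K' * dist x y" if x: "x \<in> ball x0 r" and y: "y \<notin> ball x0 r" for x y
  proof (cases "r / 2 \<le> dist x0 x")
    case False
    have "dist x0 y \<le> dist x0 x + dist x y" by (rule dist_triangle)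
    then have "r / 2 \<le> dist x y" using False y by simp
    have "\<bar>g x\<bar> \<le> 2 * C / r * (r / 2)" using C[OF x] r by simp
    also have "\<dots> \<le> K' * dist x y" using KK \<open>r / 2 \<le> dist x y\<close> r by (intro mult_mono) auto
    finally show ?thesis .
  qed (use z x KK in simp)
  have "K'-lipschitz_on UNIV ?w"
  proof (rule lipschitz_onI)
    fix x y
    consider "x \<in> ball x0 r" "y \<in> ball x0 r" | "x \<in> ball x0 r" "y \<notin> ball x0 r"
      | "x \<notin> ball x0 r" "y \<in> ball x0 r" | "x \<notin> ball x0 r" "y \<notin> ball x0 r" by blast
    then show "dist (?w x) (?w y) \<le> K' * dist x y"
    proof cases
      case 1
      have "dist (g x) (g y) \<le> K * dist x y" using lipschitz_onD[OF g 1] .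
      also have "\<dots> \<le> K' * dist x y" using KK by (intro mult_right_mono) auto
      finally show ?thesis using 1 by simp
    next
      case 2
      then show ?thesis using out[OF 2] by (simp add: dist_real_def)
    next
      case 3
      then show ?thesis using out[OF 3(2,1)] by (simp add: dist_real_def dist_commute)
    qed (use KK in auto)
  qed (use KK in auto)
  then show ?thesis by blast
qed

lemma lipschitz_on_bounded_mult:
  fixes f g :: "'a::metric_space \<Rightarrow> real"
  assumes f: "K-lipschitz_on S f" and g: "M-lipschitz_on S g"
    and B: "\<And>x. x \<in> S \<Longrightarrow> \<bar>f x\<bar> \<le> B" and C: "\<And>x. x \<in> S \<Longrightarrow> \<bar>g x\<bar> \<le> C" and "0 \<le> B" "0 \<le> C"
  shows "(B * M + C * K)-lipschitz_on S (\<lambda>x. f x * g x)"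
proof (rule lipschitz_onI)
  fix x y assume x: "x \<in> S" and y: "y \<in> S"
  have "f x * g x - f y * g y = f x * (g x - g y) + g y * (f x - f y)" by (simp add: algebra_simps)
  then have "\<bar>f x * g x - f y * g y\<bar> \<le> \<bar>f x\<bar> * \<bar>g x - g y\<bar> + \<bar>g y\<bar> * \<bar>f x - f y\<bar>"
    by (metis abs_mult abs_triangle_ineq)
  also have "\<dots> \<le> B * (M * dist x y) + C * (K * dist x y)"
    using lipschitz_onD[OF f x y] lipschitz_onD[OF g x y] B[OF x] C[OF y] \<open>0 \<le> B\<close> \<open>0 \<le> C\<close>
    by (intro add_mono mult_mono) (auto simp: dist_real_def)
  finally show "dist (f x * g x) (f y * g y) \<le> (B * M + C * K) * dist x y"
    by (simp add: dist_real_def algebra_simps)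
qed (use assms lipschitz_on_nonneg[OF f] lipschitz_on_nonneg[OF g] in auto)

lemma lipschitz_on_ball_bounded:
  fixes g :: "'a::real_normed_vector \<Rightarrow> real"
  assumes g: "K-lipschitz_on (ball x0 r) g"
  obtains C where "0 \<le> C" "\<And>x. x \<in> ball x0 r \<Longrightarrow> \<bar>g x\<bar> \<le> C"
proof
  have K: "0 \<le> K" by (rule lipschitz_on_nonneg[OF g])
  show "0 \<le> \<bar>g x0\<bar> + K * \<bar>r\<bar>" using K by simp
  fix x assume x: "x \<in> ball x0 r"
  then have "0 < r" by (metis ball_empty empty_iff not_le)
  have "\<bar>g x - g x0\<bar> \<le> K * dist x x0"
    using lipschitz_onD[OF g x, of x0] \<open>0 < r\<close> by (simp add: dist_real_def)
  also have "\<dots> \<le> K * \<bar>r\<bar>" using x K \<open>0 < r\<close> by (intro mult_left_mono) (auto simp: dist_commute)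
  finally show "\<bar>g x\<bar> \<le> \<bar>g x0\<bar> + K * \<bar>r\<bar>" by simp
qed

section \<open>Comparison with strict supersolutions\<close>

lemma open_Collect_pos_on:
  fixes f :: "'a::topological_space \<Rightarrow> real"
  assumes "continuous_on S f" "open S"
  shows "open {x \<in> S. 0 < f x}"
proof -
  have "{x \<in> S. 0 < f x} = S \<inter> f -` {0<..}" by auto
  then show ?thesis using continuous_open_preimage[OF assms open_greaterThan] by simp
qed

text \<open>Convexity of the energy density \<Phi> enters through its subgradient field
  \<open>A\<close>, and the equation through the divergence of \<open>F\<close>, the trace of
  \<open>F'\<close>. Keeping \<Phi>, \<open>A\<close> and \<open>c\<close> abstract separates the
  energy comparison from the radial computation.\<close>

lemma strict_supersolution_not_touching_above:
  fixes u \<phi> :: "real^'n \<Rightarrow> real" and F A :: "real^'n \<Rightarrow> real^'n" and F' :: "real^'n \<Rightarrow> real^'n \<Rightarrow> real^'n"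
  assumes \<Omega>: "open \<Omega>" "bounded \<Omega>"
    and u: "u \<in> W1inf0 \<Omega>"
    and min: "\<And>v. v \<in> W1inf0 \<Omega> \<Longrightarrow>
        set_lebesgue_integral lebesgue \<Omega> (\<lambda>x. \<Phi> (grad u x) - c * u x)
        \<le> set_lebesgue_integral lebesgue \<Omega> (\<lambda>x. \<Phi> (grad v x) - c * v x)"
    and \<Phi>: "continuous_on UNIV \<Phi>"
    and A: "\<And>p q. \<Phi> p + A p \<bullet> (q - p) \<le> \<Phi> q"
    and r: "r > 0" "cball x0 r \<subseteq> \<Omega>"
    and \<phi>: "\<And>x. x \<in> cball x0 r \<Longrightarrow> (\<phi> has_derivative (\<lambda>h. D\<phi> x \<bullet> h)) (at x)"
    and D\<phi>: "continuous_on (cball x0 r) D\<phi>"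
    and touch: "u x0 = \<phi> x0" "\<And>x. x \<in> \<Omega> \<Longrightarrow> x \<noteq> x0 \<Longrightarrow> u x < \<phi> x"
    and F: "\<And>x. x \<in> ball x0 r \<Longrightarrow> F x = A (D\<phi> x)"
    and F': "\<And>x. x \<in> ball x0 r \<Longrightarrow> (F has_derivative F' x) (at x)"
    and FM: "M-lipschitz_on (ball x0 r) F"
    and strict: "\<And>x. x \<in> ball x0 r \<Longrightarrow> - (\<Sum>i\<in>UNIV. F' x (axis i 1) $ i) - c > 0"
  shows False
proof -
  let ?B = "ball x0 r"
  have B\<Omega>: "?B \<subseteq> \<Omega>" using r(2) ball_subset_cball by blast
  obtain L where L: "L-lipschitz_on UNIV u" and u0: "\<And>x. x \<notin> \<Omega> \<Longrightarrow> u x = 0"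
    using u by (auto simp: W1inf0_def)
  have cu: "continuous_on UNIV u" using L by (rule lipschitz_on_continuous_on)
  have c\<phi>: "continuous_on (cball x0 r) \<phi>"
    using \<phi> by (auto intro!: continuous_at_imp_continuous_on has_derivative_continuous)
  obtain C where C: "\<And>x. x \<in> cball x0 r \<Longrightarrow> norm (D\<phi> x) \<le> C" "0 \<le> C"
  proof -
    have "bounded (D\<phi> ` cball x0 r)"
      using D\<phi> by (intro compact_imp_bounded compact_continuous_image) auto
    then obtain C where "\<forall>y\<in>D\<phi> ` cball x0 r. norm y \<le> C" by (meson bounded_iff)
    then have C: "\<And>x. x \<in> cball x0 r \<Longrightarrow> norm (D\<phi> x) \<le> C" by blast
    have "0 \<le> C" using order_trans[OF norm_ge_zero C[of x0]] r by simp
    then show thesis using C that by blast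
  qed
  have L\<phi>: "C-lipschitz_on ?B \<phi>"
  proof (rule lipschitz_on_derivative_bound)
    show "norm (D\<phi> x \<bullet> h) \<le> C * norm h" if "x \<in> ?B" for x h
      using Cauchy_Schwarz_ineq2[of "D\<phi> x" h] C(1)[of x] that
      by (simp add: order_trans[OF _ mult_right_mono])
  qed (use \<phi> C in auto)

  \<comment> \<open>A lower bound for the gap on the annulus makes the truncated function below
    vanish there, so that it extends by 0. For an empty annulus any positive value does.\<close>
  obtain \<delta> where \<delta>: "\<delta> > 0" "\<And>x. x \<in> ?B \<Longrightarrow> r / 2 \<le> dist x0 x \<Longrightarrow> \<delta> \<le> \<phi> x - u x"
  proof -
    let ?R = "cball x0 r - ball x0 (r / 2)"
    have cR: "compact ?R" by (intro compact_diff) auto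
    show thesis
    proof (cases "?R = {}")
      case True
      have "\<not> r / 2 \<le> dist x0 x" if "x \<in> ?B" for x
      proof
        assume "r / 2 \<le> dist x0 x"
        then have "x \<in> ?R" using that by simp
        then show False using True by blast
      qed
      then show thesis using that[of 1] zero_less_one by blast
    next
      case False
      have "continuous_on ?R (\<lambda>x. \<phi> x - u x)"
        by (intro continuous_intros continuous_on_subset[OF c\<phi>] continuous_on_subset[OF cu]) auto
      from continuous_attains_inf[OF cR False this]
      obtain y where y: "y \<in> ?R" "\<forall>x\<in>?R. \<phi> y - u y \<le> \<phi> x - u x" by blast
      have "y \<in> \<Omega>" "y \<noteq> x0" using y r by auto
      then have "0 < \<phi> y - u y" using touch(2) by simp
      then show thesis using y(2) by (intro that[of "\<phi> y - u y"]) auto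
    qed
  qed
  define g where "g = (\<lambda>x. max 0 (u x - \<phi> x + \<delta>))"
  define w where "w = (\<lambda>x. if x \<in> ?B then g x else 0)"
  have g0: "g x = 0" if "x \<in> ?B" "r / 2 \<le> dist x0 x" for x using \<delta>(2)[OF that] by (simp add: g_def)
  have w0: "w x = 0" if "r / 2 \<le> dist x0 x" for x using g0[of x] that by (simp add: w_def)
  have wnn: "0 \<le> w x" for x by (simp add: w_def g_def)
  have Lg: "(L + C)-lipschitz_on ?B g"
  proof (rule lipschitz_onI)
    fix x y assume xy: "x \<in> ?B" "y \<in> ?B"
    have "\<bar>u x - u y\<bar> \<le> L * dist x y" using lipschitz_onD[OF L, of x y] by (simp add: dist_real_def)
    moreover have "\<bar>\<phi> x - \<phi> y\<bar> \<le> C * dist x y" using lipschitz_onD[OF L\<phi> xy] by (simp add: dist_real_def)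
    moreover have "\<bar>max 0 a - max 0 b\<bar> \<le> \<bar>a - b\<bar>" for a b :: real by (auto simp: max_def)
    then have "\<bar>g x - g y\<bar> \<le> \<bar>(u x - \<phi> x + \<delta>) - (u y - \<phi> y + \<delta>)\<bar>" unfolding g_def .
    ultimately show "dist (g x) (g y) \<le> (L + C) * dist x y"
      by (simp add: dist_real_def algebra_simps)
  qed (use lipschitz_on_nonneg[OF L] C in auto)
  obtain Lw where Lw: "Lw-lipschitz_on UNIV w"
    using lipschitz_on_extend_zero[OF Lg r(1) g0] unfolding w_def by blast

  define v where "v = (\<lambda>x. u x - w x)"
  have Lv: "(L + Lw)-lipschitz_on UNIV v" unfolding v_def by (rule lipschitz_on_diff[OF L Lw])
  have "v x = 0" if "x \<notin> \<Omega>" for x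
  proof -
    have "x \<notin> ?B" using that B\<Omega> by blast
    then show ?thesis using u0[OF that] by (simp add: v_def w_def)
  qed
  then have vW: "v \<in> W1inf0 \<Omega>" using Lv by (auto simp: W1inf0_def)

  have point: "(if x \<in> ?B then F x \<bullet> grad w x else 0) \<le> \<Phi> (grad u x) - \<Phi> (grad v x)"
    if du: "(u has_derivative (\<lambda>h. grad u x \<bullet> h)) (at x)"
      and dw: "(w has_derivative (\<lambda>h. grad w x \<bullet> h)) (at x)" for x
  proof -
    have "(v has_derivative (\<lambda>h. (grad u x - grad w x) \<bullet> h)) (at x)"
      unfolding v_def using has_derivative_diff[OF du dw] by (simp add: inner_diff_left)
    then have gv: "grad v x = grad u x - grad w x" by (rule grad_eqI)
    show ?thesis
    proof (cases "w x = 0")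
      case True
      \<comment> \<open>Since \<open>w\<close> is nonnegative, it has a minimum at \<open>x\<close>;
        so the gradients of \<open>u\<close> and \<open>v\<close> coincide there.\<close>
      have "(\<lambda>h. grad w x \<bullet> h) = (\<lambda>h. 0)"
        by (rule differential_zero_maxmin[OF UNIV_I open_UNIV dw]) (use True wnn in auto)
      then have "grad w x \<bullet> grad w x = 0" by metis
      then show ?thesis using gv by simp
    next
      case False
      then have xB: "x \<in> ?B" by (auto simp: w_def split: if_splits)
      have gx: "0 < u x - \<phi> x + \<delta>" using False xB by (auto simp: w_def g_def max_def split: if_splits)
      define U where "U = {y \<in> ?B. 0 < u y - \<phi> y + \<delta>}"
      have "open U" unfolding U_def
      proof (rule open_Collect_pos_on)
        show "continuous_on ?B (\<lambda>y. u y - \<phi> y + \<delta>)"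
          by (intro continuous_intros continuous_on_subset[OF c\<phi>] continuous_on_subset[OF cu]) auto
      qed simp
      \<comment> \<open>Near such a point \<open>v\<close> equals \<open>\<phi> - \<delta>\<close>,
        so the gradient of \<open>v\<close> is that of \<phi>; the subgradient inequality is used
        with this base point.\<close>
      have "((\<lambda>y. u y - \<phi> y + \<delta>) has_derivative (\<lambda>h. (grad u x - D\<phi> x) \<bullet> h)) (at x)"
        using has_derivative_add[OF has_derivative_diff[OF du \<phi>[of x]] has_derivative_const[of \<delta>]] xB
        by (simp add: inner_diff_left)
      then have "(w has_derivative (\<lambda>h. (grad u x - D\<phi> x) \<bullet> h)) (at x)"
        by (rule has_derivative_transform_within_open[OF _ \<open>open U\<close>])
           (use xB gx in \<open>auto simp: U_def w_def g_def\<close>)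
      then have gw: "grad w x = grad u x - D\<phi> x" by (rule grad_eqI)
      have "\<Phi> (D\<phi> x) + A (D\<phi> x) \<bullet> (grad u x - D\<phi> x) \<le> \<Phi> (grad u x)" by (rule A)
      then show ?thesis using xB F[OF xB] gv gw by simp
    qed
  qed

  define W where "W = (\<lambda>i x. if x \<in> ?B then w x * F x $ i else 0)"
  have LW: "\<exists>K. K-lipschitz_on UNIV (W i)" for i
  proof -
    have Fi: "M-lipschitz_on ?B (\<lambda>x. F x $ i)"
    proof (rule lipschitz_onI)
      fix x y assume "x \<in> ?B" "y \<in> ?B"
      then have "dist (F x) (F y) \<le> M * dist x y" by (rule lipschitz_onD[OF FM])
      then show "dist (F x $ i) (F y $ i) \<le> M * dist x y" using dist_vec_nth_le order_trans by blast
    qed (rule lipschitz_on_nonneg[OF FM])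
    have wB: "Lw-lipschitz_on ?B w" using lipschitz_on_subset[OF Lw] by simp
    obtain c1 where c1: "0 \<le> c1" "\<And>x. x \<in> ?B \<Longrightarrow> \<bar>F x $ i\<bar> \<le> c1"
      using lipschitz_on_ball_bounded[OF Fi] by blast
    obtain c2 where c2: "0 \<le> c2" "\<And>x. x \<in> ?B \<Longrightarrow> \<bar>w x\<bar> \<le> c2"
      using lipschitz_on_ball_bounded[OF wB] by blast
    have "(c2 * M + c1 * Lw)-lipschitz_on ?B (\<lambda>x. w x * F x $ i)"
      by (rule lipschitz_on_bounded_mult[OF wB Fi c2(2) c1(2) c2(1) c1(1)])
    from lipschitz_on_extend_zero[OF this r(1)] show ?thesis
      unfolding W_def using w0 by simp
  qed
  \<comment> \<open>This is the divergence of \<open>w\<close> times \<open>F\<close>, a compactly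
    supported Lipschitz field, so its integral is 0.\<close>
  define Z where "Z = (\<lambda>x. \<Sum>i\<in>UNIV. dirderiv (W i) (axis i 1) x)"
  have Wsupp: "W i x = 0" if "norm x > norm x0 + r" for i x
  proof -
    have "norm x \<le> norm x0 + dist x0 x" using norm_triangle_sub[of x x0] by (simp add: dist_norm norm_minus_commute)
    then show ?thesis using that by (simp add: W_def)
  qed
  have Wi: "integrable lborel (dirderiv (W i) (axis i 1))" "(LINT x|lborel. dirderiv (W i) (axis i 1) x) = 0" for i
  proof -
    obtain K where K: "K-lipschitz_on UNIV (W i)" using LW by blast
    show "integrable lborel (dirderiv (W i) (axis i 1))" by (rule integrable_dirderiv[OF K Wsupp])
    show "(LINT x|lborel. dirderiv (W i) (axis i 1) x) = 0" by (rule integral_dirderiv_eq_0[OF K Wsupp])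
  qed
  have Zb: "integrable lborel Z" "(LINT x|lborel. Z x) = 0"
    unfolding Z_def using Wi by auto
  then have Zl: "integrable lebesgue Z" "(LINT x|lebesgue. Z x) = 0"
    using integrable_completion[of Z lborel] integral_completion[of Z lborel] by auto

  have Zx: "Z x = (if x \<in> ?B then F x \<bullet> grad w x + w x * (\<Sum>i\<in>UNIV. F' x (axis i 1) $ i) else 0)"
    if dw: "(w has_derivative (\<lambda>h. grad w x \<bullet> h)) (at x)" for x
  proof (cases "x \<in> ?B")
    case True
    have "dirderiv (W i) (axis i 1) x = F x $ i * grad w x $ i + w x * F' x (axis i 1) $ i" for i
    proof -
      have "((\<lambda>y. F y $ i) has_derivative (\<lambda>h. F' x h $ i)) (at x)"
        using bounded_linear.has_derivative[OF bounded_linear_vec_nth F'[OF True]] .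
      from has_derivative_mult[OF dw this]
      have "((\<lambda>y. w y * F y $ i) has_derivative (\<lambda>h. w x * F' x h $ i + grad w x \<bullet> h * F x $ i)) (at x)" .
      then have "(W i has_derivative (\<lambda>h. w x * F' x h $ i + grad w x \<bullet> h * F x $ i)) (at x)"
        by (rule has_derivative_transform_within_open[OF _ open_ball True]) (simp add: W_def)
      from has_derivative_imp_dirderiv[OF this, of "axis i 1"] show ?thesis
        by (simp add: inner_axis mult.commute)
    qed
    then show ?thesis using True
      by (simp add: Z_def sum.distrib sum_distrib_left inner_vec_def)
  next
    case False
    have "dirderiv (W i) (axis i 1) x = 0" for i
    proof -
      \<comment> \<open>Since \<open>w\<close> already vanishes beyond radius \<open>r / 2\<close>,
        points on the boundary sphere of the ball also have a neighbourhood on which the field is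
        0.\<close>
      have "open (- cball x0 (r / 2))" by (simp add: open_Compl)
      have "(W i has_derivative (\<lambda>h. 0)) (at x)"
      proof (rule has_derivative_transform_within_open[OF has_derivative_const[of 0] \<open>open (- cball x0 (r / 2))\<close>])
        show "x \<in> - cball x0 (r / 2)" using False r by auto
        show "0 = W i y" if "y \<in> - cball x0 (r / 2)" for y
          using that w0[of y] by (simp add: W_def)
      qed
      from has_derivative_imp_dirderiv[OF this] show ?thesis .
    qed
    then show ?thesis using False by (simp add: Z_def)
  qed

  define I where "I = (\<lambda>x. indicator \<Omega> x *\<^sub>R (\<Phi> (grad u x) - c * u x) - indicator \<Omega> x *\<^sub>R (\<Phi> (grad v x) - c * v x))"
  have iu: "integrable lebesgue (\<lambda>x. indicator \<Omega> x *\<^sub>R (\<Phi> (grad u x) - c * u x))"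
    by (rule integrable_energy[OF L \<Omega> \<Phi>])
  have iv: "integrable lebesgue (\<lambda>x. indicator \<Omega> x *\<^sub>R (\<Phi> (grad v x) - c * v x))"
    by (rule integrable_energy[OF Lv \<Omega> \<Phi>])
  have I: "integrable lebesgue I" unfolding I_def using iu iv by (rule Bochner_Integration.integrable_diff)
  have I0: "(LINT x|lebesgue. I x) \<le> 0"
    unfolding I_def Bochner_Integration.integral_diff[OF iu iv]
    using min[OF vW] by (simp add: set_lebesgue_integral_def)
  \<comment> \<open>This is \<open>w\<close> times the strictly positive operator. The product rule
    cancels the gradient terms and gives \<open>T \<le> I - Z\<close>; minimality makes the integral
    of \<open>I - Z\<close> nonpositive, which forces \<open>T = 0\<close> almost
    everywhere.\<close>
  define T where "T = (\<lambda>x. if x \<in> ?B then w x * (- (\<Sum>i\<in>UNIV. F' x (axis i 1) $ i) - c) else 0)"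
  have T0: "0 \<le> T x" for x
    using wnn[of x] strict[of x] by (auto simp: T_def intro!: mult_nonneg_nonneg)
  have TI: "AE x in lebesgue. T x \<le> I x - Z x"
    using grad_AE[OF L] grad_AE[OF Lw]
  proof eventually_elim
    case (elim x)
    show ?case
    proof (cases "x \<in> \<Omega>")
      case True
      have "I x = \<Phi> (grad u x) - \<Phi> (grad v x) - c * w x"
        using True by (simp add: I_def v_def algebra_simps)
      moreover have "w x = 0" if "x \<notin> ?B" using that by (simp add: w_def)
      ultimately show ?thesis using point[OF elim] Zx[OF elim(2)]
        by (cases "x \<in> ?B") (auto simp: T_def algebra_simps)
    next
      case False
      then have "x \<notin> ?B" using B\<Omega> by blast
      then show ?thesis using False Zx[OF elim(2)] by (simp add: T_def I_def)
    qed
  qed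
  have IZ: "integrable lebesgue (\<lambda>x. I x - Z x)" using I Zl(1) by (rule Bochner_Integration.integrable_diff)
  have nn: "AE x in lebesgue. 0 \<le> I x - Z x" using TI by eventually_elim (use T0 order_trans in blast)
  have "(LINT x|lebesgue. I x - Z x) \<le> 0"
    using I0 Zl by (simp add: Bochner_Integration.integral_diff[OF I Zl(1)])
  moreover have "0 \<le> (LINT x|lebesgue. I x - Z x)" using nn by (rule integral_nonneg_AE)
  ultimately have "(LINT x|lebesgue. I x - Z x) = 0" by simp
  then have "AE x in lebesgue. I x - Z x = 0"
    using integral_nonneg_eq_0_iff_AE[OF IZ nn] by simp
  with TI have T_zero: "AE x in lebesgue. T x = 0"
    by eventually_elim (use T0 in \<open>force intro: antisym\<close>)

  \<comment> \<open>On this open neighbourhood of \<open>x0\<close> the function \<open>T\<close> is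
    positive, yet a nonempty open set is not null.\<close>
  define U where "U = {y \<in> ?B. 0 < u y - \<phi> y + \<delta>}"
  have "open U" unfolding U_def
  proof (rule open_Collect_pos_on)
    show "continuous_on ?B (\<lambda>y. u y - \<phi> y + \<delta>)"
      by (intro continuous_intros continuous_on_subset[OF c\<phi>] continuous_on_subset[OF cu]) auto
  qed simp
  have "x0 \<in> U" using r \<delta>(1) touch(1) by (simp add: U_def)
  have Tpos: "T x > 0" if "x \<in> U" for x
    using that strict[of x] by (auto simp: T_def U_def w_def g_def max_def)
  have "AE x in lebesgue. x \<notin> U" using T_zero by eventually_elim (use Tpos in force)
  then have "U \<in> null_sets lebesgue"
    using \<open>open U\<close> by (subst AE_iff_null_sets) (auto simp: borel_open)
  then have "negligible U" by (simp add: negligible_iff_null_sets)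
  then show False using open_not_negligible[OF \<open>open U\<close>] \<open>x0 \<in> U\<close> by blast
qed

section \<open>The minimizer as a viscosity solution\<close>

text \<open>Cauchy-Schwarz with \<open>f1 \<ge> 0\<close> reduces the inequality to the tangent of
  \<open>f\<close> at \<open>norm p\<close>. For \<open>p = 0\<close> the vector vanishes and
  monotonicity remains.\<close>

lemma radial_subgradient:
  fixes p q :: "'a::real_inner"
  assumes f_convex: "convex_on {0..} f" and f_mono: "mono_on {0..} f"
    and f_d1: "\<And>s. s \<ge> 0 \<Longrightarrow> (f has_real_derivative f1 s) (at s within {0..})"
  shows "f (norm p) + ((f1 (norm p) / norm p) *\<^sub>R p) \<bullet> (q - p) \<le> f (norm q)"
proof (cases "p = 0")
  case True
  then show ?thesis using f_mono by (simp add: mono_on_def)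
next
  case False
  define s where "s = norm p"
  have s: "s > 0" using False by (simp add: s_def)
  have tangent: "f1 s * (t - s) \<le> f t - f s" if "t \<ge> 0" for t
  proof (rule convex_on_imp_above_tangent[OF f_convex])
    show "connected {0::real..}" by (simp add: convex_connected)
    show "s \<in> interior {0..}" using s by simp
    show "(f has_real_derivative f1 s) (at s within {0..})" using f_d1 s by simp
  qed (use that in auto)
  have "f 0 \<le> f s" using f_mono s by (simp add: mono_on_def)
  \<comment> \<open>The tangent at \<open>s\<close>, evaluated at 0, lies below \<open>f 0\<close>,
    which is at most \<open>f s\<close>.\<close>
  then have "f1 s * s \<ge> 0" using tangent[of 0] by simp
  then have f1: "f1 s \<ge> 0" using s by (simp add: zero_le_mult_iff)
  have "p \<bullet> (q - p) = p \<bullet> q - s * s"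
    by (simp add: inner_diff_right s_def dot_square_norm power2_eq_square)
  then have "((f1 s / s) *\<^sub>R p) \<bullet> (q - p) = (f1 s / s) * (p \<bullet> q - s * s)" by simp
  also have "\<dots> \<le> (f1 s / s) * (s * norm q - s * s)"
    using f1 s norm_cauchy_schwarz[of p q] by (intro mult_left_mono) (auto simp: s_def)
  also have "\<dots> = f1 s * (norm q - s)" using s by (simp add: field_simps)
  also have "\<dots> \<le> f (norm q) - f s" using tangent by simp
  finally show ?thesis by (simp add: s_def)
qed

section \<open>The radial field along a test function and its divergence\<close>

lemma norm_matrix_vector_mult_le:
  fixes A :: "real^'n^'m"
  shows "norm (A *v h) \<le> (\<Sum>i\<in>UNIV. \<Sum>j\<in>UNIV. \<bar>A $ i $ j\<bar>) * norm h"
proof -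
  have "norm (A *v h) \<le> onorm ((*v) A) * norm h"
    by (rule onorm) (rule matrix_vector_mul_bounded_linear)
  also have "\<dots> \<le> (\<Sum>i\<in>UNIV. \<Sum>j\<in>UNIV. \<bar>A $ i $ j\<bar>) * norm h"
    by (intro mult_right_mono onorm_le_matrix_component_sum) simp
  finally show ?thesis .
qed

lemma continuous_on_matrix_vector_mult:
  fixes A :: "'a::topological_space \<Rightarrow> real^'n^'m"
  assumes "continuous_on S A" "continuous_on S x"
  shows "continuous_on S (\<lambda>y. A y *v x y)"
  unfolding matrix_vector_mult_def
  by (intro continuous_intros continuous_on_vec_lambda continuous_on_component assms)

text \<open>The derivative of \<open>f1 t / t\<close> brings the factor \<open>1 / s ^ 2\<close>,
  and the normalized vector \<open>sgn (D x)\<close> from the derivative of the norm brings the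
  third power. These are the coefficients of the operator.\<close>

lemma radial_field_has_derivative:
  fixes D :: "real^'n \<Rightarrow> real^'n" and H :: "real^'n^'n"
  assumes D: "(D has_derivative (\<lambda>h. H *v h)) (at x)" and nz: "D x \<noteq> 0"
    and f_d2: "(f1 has_real_derivative f2) (at (norm (D x)))"
  shows "((\<lambda>y. (f1 (norm (D y)) / norm (D y)) *\<^sub>R D y) has_derivative
     (\<lambda>h. ((norm (D x) * f2 - f1 (norm (D x))) / norm (D x) ^ 3 * (D x \<bullet> (H *v h))) *\<^sub>R D x
          + (f1 (norm (D x)) / norm (D x)) *\<^sub>R (H *v h))) (at x)"
proof -
  define s where "s = norm (D x)"
  have s: "s > 0" using nz by (simp add: s_def)
  have "((\<lambda>t. f1 t / t) has_real_derivative (f2 * s - f1 s) / (s * s)) (at s)"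
    using DERIV_divide[OF f_d2[folded s_def] DERIV_ident] s by simp
  then have b: "((\<lambda>t. f1 t / t) has_derivative (\<lambda>t. (f2 * s - f1 s) / (s * s) * t)) (at (norm (D x)))"
    by (simp only: has_field_derivative_def s_def)
  have n: "((\<lambda>y. norm (D y)) has_derivative (\<lambda>h. (H *v h) \<bullet> sgn (D x))) (at x)"
    by (rule has_derivative_compose[OF D has_derivative_norm[OF nz]])
  note bn = has_derivative_compose[OF n b]
  have "((\<lambda>y. (f1 (norm (D y)) / norm (D y)) *\<^sub>R D y) has_derivative
     (\<lambda>h. (f1 (norm (D x)) / norm (D x)) *\<^sub>R (H *v h)
        + ((f2 * s - f1 s) / (s * s) * ((H *v h) \<bullet> sgn (D x))) *\<^sub>R D x)) (at x)"
    by (rule has_derivative_scaleR[OF bn D])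
  moreover have "(f2 * s - f1 s) / (s * s) * ((H *v h) \<bullet> sgn (D x))
      = (s * f2 - f1 s) / s ^ 3 * (D x \<bullet> (H *v h))" for h
  proof -
    have "(H *v h) \<bullet> sgn (D x) = (D x \<bullet> (H *v h)) / s"
      by (simp add: sgn_div_norm s_def inner_commute divide_inverse)
    then show ?thesis using s by (simp add: power3_eq_cube mult.commute)
  qed
  ultimately show ?thesis by (simp add: s_def add.commute)
qed

text \<open>Tracing the derivative gives the divergence: the rank-one part yields the quadratic form
  and the other part the trace, as in the first entry of the operator.\<close>

lemma sum_radial_field_derivative:
  fixes P :: "real^'n" and H :: "real^'n^'n"
  shows "(\<Sum>i\<in>UNIV. ((a * (P \<bullet> (H *v axis i 1))) *\<^sub>R P + b *\<^sub>R (H *v axis i 1)) $ i)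
     = a * (P \<bullet> (H *v P)) + b * trace H"
proof -
  have e: "(H *v axis i 1) $ j = H $ j $ i" for i j
    by (simp add: matrix_vector_mult_basis column_def)
  have "(\<Sum>i\<in>UNIV. (P \<bullet> (H *v axis i 1)) * P $ i) = (\<Sum>i\<in>UNIV. \<Sum>j\<in>UNIV. P $ j * H $ j $ i * P $ i)"
    by (simp add: inner_vec_def e sum_distrib_right)
  also have "\<dots> = (\<Sum>j\<in>UNIV. \<Sum>i\<in>UNIV. P $ j * H $ j $ i * P $ i)" by (rule sum.swap)
  also have "\<dots> = P \<bullet> (H *v P)"
    by (simp add: inner_vec_def matrix_vector_mult_def sum_distrib_left mult.assoc)
  finally have "(\<Sum>i\<in>UNIV. (P \<bullet> (H *v axis i 1)) * P $ i) = P \<bullet> (H *v P)" .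
  then show ?thesis
    by (simp add: sum.distrib e trace_def sum_distrib_left[symmetric] mult.assoc)
qed

text \<open>Positivity of the first entry at \<open>x0\<close> spreads to a ball by continuity,
  which contradicts the comparison lemma. The cases \<open>c = 1\<close> and \<open>c = -1\<close>
  serve touching from above and, after reflection, from below.\<close>

lemma minimizer_touched_from_above:
  fixes u \<phi> :: "real^'n \<Rightarrow> real"
  assumes \<Omega>: "open \<Omega>" "bounded \<Omega>" and sigma: "\<sigma> > 0"
    and f_convex: "convex_on {0..} f" and f_mono: "mono_on {0..} f"
    and f_d1: "\<And>s. s \<ge> 0 \<Longrightarrow> (f has_real_derivative f1 s) (at s within {0..})"
    and f1_cont: "continuous_on {0..} f1"
    and f_d2: "\<And>s. s > 0 \<Longrightarrow> (f1 has_real_derivative f2 s) (at s)"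
    and f2_cont: "continuous_on {0<..} f2"
    and f1_flat: "\<And>s. 0 \<le> s \<Longrightarrow> s \<le> \<sigma> \<Longrightarrow> f1 s = 0"
    and u: "u \<in> W1inf0 \<Omega>"
    and min: "\<And>v. v \<in> W1inf0 \<Omega> \<Longrightarrow>
        set_lebesgue_integral lebesgue \<Omega> (\<lambda>x. f (norm (grad u x)) - c * u x)
        \<le> set_lebesgue_integral lebesgue \<Omega> (\<lambda>x. f (norm (grad v x)) - c * v x)"
    and x0: "x0 \<in> \<Omega>" and C2: "C2_on \<Omega> \<phi> D\<phi> H\<phi>"
    and touch: "u x0 = \<phi> x0" "\<And>x. x \<in> \<Omega> \<Longrightarrow> x \<noteq> x0 \<Longrightarrow> u x < \<phi> x"
  shows "(if D\<phi> x0 = 0 then - c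
     else - ((norm (D\<phi> x0) * f2 (norm (D\<phi> x0)) - f1 (norm (D\<phi> x0))) / norm (D\<phi> x0) ^ 3)
              * (D\<phi> x0 \<bullet> (H\<phi> x0 *v D\<phi> x0))
          - (f1 (norm (D\<phi> x0)) / norm (D\<phi> x0)) * trace (H\<phi> x0) - c) \<le> 0"
proof (rule ccontr)
  assume neg: "\<not> ?thesis"
  define a where "a = (\<lambda>s. (s * f2 s - f1 s) / s ^ 3)"
  define b where "b = (\<lambda>s. f1 s / s)"
  define F where "F = (\<lambda>x. b (norm (D\<phi> x)) *\<^sub>R D\<phi> x)"
  have d1: "(\<phi> has_derivative (\<lambda>h. D\<phi> x \<bullet> h)) (at x)" 
    and d2: "(D\<phi> has_derivative (\<lambda>h. H\<phi> x *v h)) (at x)" if "x \<in> \<Omega>" for x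
    using C2 that by (auto simp: C2_on_def)
  have cD: "continuous_on \<Omega> D\<phi>"
    using d2 by (auto intro!: continuous_at_imp_continuous_on has_derivative_continuous)
  have cH: "continuous_on \<Omega> H\<phi>" using C2 by (simp add: C2_on_def)
  have cf: "continuous_on {0..} f"
    using f_d1 by (auto intro!: DERIV_continuous simp: continuous_on_eq_continuous_within)
  have c\<Phi>: "continuous_on UNIV (\<lambda>p::real^'n. f (norm p))"
    by (rule continuous_on_compose2[OF cf]) (auto intro: continuous_intros)
  have A: "f (norm p) + (b (norm p) *\<^sub>R p) \<bullet> (q - p) \<le> f (norm q)" for p q :: "real^'n"
    unfolding b_def by (rule radial_subgradient[OF f_convex f_mono f_d1])
  have no: False if r: "r > 0" "cball x0 r \<subseteq> \<Omega>"
      and F': "\<And>x. x \<in> ball x0 r \<Longrightarrow> (F has_derivative F' x) (at x)"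
      and FM: "M-lipschitz_on (ball x0 r) F"
      and strict: "\<And>x. x \<in> ball x0 r \<Longrightarrow> - (\<Sum>i\<in>UNIV. F' x (axis i 1) $ i) - c > 0" for r F' M
  proof (rule strict_supersolution_not_touching_above[where \<Phi> = "\<lambda>p. f (norm p)"
        and A = "\<lambda>p. b (norm p) *\<^sub>R p", OF \<Omega> u min c\<Phi> A r _ _ touch _ F' FM strict])
    show "(\<phi> has_derivative (\<lambda>h. D\<phi> x \<bullet> h)) (at x)" if "x \<in> cball x0 r" for x using d1 that r by auto
    show "continuous_on (cball x0 r) D\<phi>" using cD r continuous_on_subset by blast
  qed (auto simp: F_def)
  show False
  proof (cases "D\<phi> x0 = 0")
    case True
    \<comment> \<open>Near a critical point the gradient stays below \<sigma>, so the field is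
      identically 0 and strictness reduces to \<open>- c > 0\<close>.\<close>
    have "open {x \<in> \<Omega>. 0 < \<sigma> - norm (D\<phi> x)}"
      by (intro open_Collect_pos_on continuous_intros cD \<Omega>)
    moreover have "x0 \<in> {x \<in> \<Omega>. 0 < \<sigma> - norm (D\<phi> x)}" using True x0 sigma by simp
    ultimately obtain r where r: "r > 0" "cball x0 r \<subseteq> {x \<in> \<Omega>. 0 < \<sigma> - norm (D\<phi> x)}"
      using open_contains_cball by blast
    have F0: "F x = 0" if "x \<in> ball x0 r" for x
      using that r f1_flat[of "norm (D\<phi> x)"] by (auto simp: F_def b_def dest!: subsetD[of _ _ x])
    show False
    proof (rule no[of r "\<lambda>x h. 0" 0])
      show "(F has_derivative (\<lambda>h. 0)) (at x)" if "x \<in> ball x0 r" for x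
        by (rule has_derivative_transform_within_open[OF has_derivative_const[of 0] open_ball that])
           (simp add: F0)
      show "0-lipschitz_on (ball x0 r) F" using F0 by (intro lipschitz_onI) auto
      show "- (\<Sum>i\<in>UNIV. (0::real^'n) $ i) - c > 0" using neg True by simp
    qed (use r in auto)
  next
    case False
    define E where "E = (\<lambda>x. - a (norm (D\<phi> x)) * (D\<phi> x \<bullet> (H\<phi> x *v D\<phi> x)) - b (norm (D\<phi> x)) * trace (H\<phi> x) - c)"
    define V where "V = {x \<in> \<Omega>. 0 < norm (D\<phi> x)}"
    have "open V" unfolding V_def by (intro open_Collect_pos_on continuous_intros cD \<Omega>)
    have V\<Omega>: "V \<subseteq> \<Omega>" by (auto simp: V_def)
    have cDV: "continuous_on V D\<phi>" and cHV: "continuous_on V H\<phi>"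
      using cD cH V\<Omega> continuous_on_subset by blast+
    have cn: "continuous_on V (\<lambda>x. norm (D\<phi> x))" by (intro continuous_intros cDV)
    have cf1: "continuous_on V (\<lambda>x. f1 (norm (D\<phi> x)))"
      by (rule continuous_on_compose2[OF f1_cont cn]) auto
    have cf2: "continuous_on V (\<lambda>x. f2 (norm (D\<phi> x)))"
      by (rule continuous_on_compose2[OF f2_cont cn]) (auto simp: V_def)
    have nz: "norm (D\<phi> x) \<noteq> 0" "norm (D\<phi> x) ^ 3 \<noteq> 0" if "x \<in> V" for x using that by (auto simp: V_def)
    have ca: "continuous_on V (\<lambda>x. a (norm (D\<phi> x)))"
      unfolding a_def by (intro continuous_intros cn cf1 cf2) (use nz in blast)
    have cb: "continuous_on V (\<lambda>x. b (norm (D\<phi> x)))"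
      unfolding b_def by (intro continuous_intros cn cf1) (use nz in blast)
    have cHij: "continuous_on V (\<lambda>x. H\<phi> x $ i $ j)" for i j
      by (intro continuous_on_component cHV)
    have "continuous_on V E"
      unfolding E_def trace_def
      by (intro continuous_intros ca cb cHij continuous_on_matrix_vector_mult cDV cHV)
    then have "open {x \<in> V. 0 < E x}" using \<open>open V\<close> by (rule open_Collect_pos_on)
    moreover have "x0 \<in> {x \<in> V. 0 < E x}"
      using False neg x0 by (simp add: V_def E_def a_def b_def not_le)
    ultimately obtain r where r: "r > 0" "cball x0 r \<subseteq> {x \<in> V. 0 < E x}"
      using open_contains_cball by blast
    have rV: "cball x0 r \<subseteq> V" using r by blast
    \<comment> \<open>A continuous bound for the operator norm of the derivative of
      \<open>F\<close>; its maximum on the compact ball is the Lipschitz constant required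
      there.\<close>
    define Q where "Q = (\<lambda>x. (\<bar>a (norm (D\<phi> x))\<bar> * (norm (D\<phi> x) * norm (D\<phi> x)) + \<bar>b (norm (D\<phi> x))\<bar>)
        * (\<Sum>i\<in>UNIV. \<Sum>j\<in>UNIV. \<bar>H\<phi> x $ i $ j\<bar>))"
    have "continuous_on V Q" unfolding Q_def by (intro continuous_intros ca cb cn cHij)
    then have "bounded (Q ` cball x0 r)"
      using rV by (intro compact_imp_bounded compact_continuous_image) (auto intro: continuous_on_subset)
    then obtain B where "\<forall>y\<in>Q ` cball x0 r. norm y \<le> B" by (meson bounded_iff)
    then have B: "\<bar>Q x\<bar> \<le> B" if "x \<in> cball x0 r" for x using that by auto
    have B0: "0 \<le> B" using B[of x0] r by (simp add: order_trans[OF abs_ge_zero])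
    define F' where "F' = (\<lambda>x h. (a (norm (D\<phi> x)) * (D\<phi> x \<bullet> (H\<phi> x *v h))) *\<^sub>R D\<phi> x
        + b (norm (D\<phi> x)) *\<^sub>R (H\<phi> x *v h))"
    have dF: "(F has_derivative F' x) (at x)" if "x \<in> ball x0 r" for x
    proof -
      have "x \<in> V" using that rV by auto
      then have "x \<in> \<Omega>" "D\<phi> x \<noteq> 0" by (auto simp: V_def)
      then show ?thesis
        unfolding F_def F'_def a_def b_def using f_d2 by (intro radial_field_has_derivative d2) auto
    qed
    have bF: "norm (F' x h) \<le> B * norm h" if "x \<in> ball x0 r" for x h
    proof -
      let ?P = "D\<phi> x" and ?N = "\<Sum>i\<in>UNIV. \<Sum>j\<in>UNIV. \<bar>H\<phi> x $ i $ j\<bar>"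
      have "norm (F' x h) \<le> \<bar>a (norm ?P)\<bar> * \<bar>?P \<bullet> (H\<phi> x *v h)\<bar> * norm ?P + \<bar>b (norm ?P)\<bar> * norm (H\<phi> x *v h)"
        unfolding F'_def by (rule order_trans[OF norm_triangle_ineq]) (simp add: abs_mult)
      also have "\<dots> \<le> \<bar>a (norm ?P)\<bar> * (norm ?P * norm (H\<phi> x *v h)) * norm ?P + \<bar>b (norm ?P)\<bar> * norm (H\<phi> x *v h)"
        by (intro add_right_mono mult_right_mono mult_left_mono Cauchy_Schwarz_ineq2) auto
      also have "\<dots> = (\<bar>a (norm ?P)\<bar> * (norm ?P * norm ?P) + \<bar>b (norm ?P)\<bar>) * norm (H\<phi> x *v h)"
        by (simp add: algebra_simps)
      also have "\<dots> \<le> (\<bar>a (norm ?P)\<bar> * (norm ?P * norm ?P) + \<bar>b (norm ?P)\<bar>) * (?N * norm h)"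
        by (intro mult_left_mono norm_matrix_vector_mult_le) auto
      also have "\<dots> = Q x * norm h" by (simp add: Q_def)
      also have "\<dots> \<le> B * norm h" using B[of x] that by (intro mult_right_mono) auto
      finally show ?thesis .
    qed
    show False
    proof (rule no[of r F' B])
      show "B-lipschitz_on (ball x0 r) F"
        by (rule lipschitz_on_derivative_bound[OF convex_ball dF bF B0])
      show "- (\<Sum>i\<in>UNIV. F' x (axis i 1) $ i) - c > 0" if "x \<in> ball x0 r" for x
      proof -
        have "x \<in> cball x0 r" using that by simp
        then have "0 < E x" using r(2) by blast
        then show ?thesis by (simp only: F'_def sum_radial_field_derivative) (simp add: E_def)
      qed
    qed (use r rV V\<Omega> dF in auto)
  qed
qed

section \<open>Reflection and the two viscosity inequalities\<close>

lemma W1inf0_uminus: "v \<in> W1inf0 \<Omega> \<Longrightarrow> (\<lambda>x. - v x) \<in> W1inf0 \<Omega>"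
  by (auto simp: W1inf0_def)

lemma C2_on_uminus:
  fixes D :: "real^'n \<Rightarrow> real^'n"
  assumes "C2_on U \<phi> D H"
  shows "C2_on U (\<lambda>x. - \<phi> x) (\<lambda>x. - D x) (\<lambda>x. - H x)"
proof -
  have m: "(- X) *v h = - (X *v h)" for X :: "real^'n^'n" and h
    by (simp add: matrix_vector_mult_def vec_eq_iff sum_negf)
  have "((\<lambda>x. - \<phi> x) has_derivative (\<lambda>h. (- D x) \<bullet> h)) (at x)"
    "((\<lambda>x. - D x) has_derivative (\<lambda>h. (- H x) *v h)) (at x)" if "x \<in> U" for x
    using has_derivative_minus[of \<phi>] has_derivative_minus[of D] assms that
    by (auto simp: C2_on_def m)
  then show ?thesis using assms by (auto simp: C2_on_def intro: continuous_on_minus)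
qed

text \<open>A minimum is nonpositive once its first entry is, which settles touching from above.
  Touching from below needs both entries: reflection gives the first, and flatness of
  \<open>f1\<close> then excludes gradients shorter than \<sigma>.\<close>

lemma minimizer_visc_solution:
  fixes \<Omega> :: "(real^'n) set" and u :: "real^'n \<Rightarrow> real"
  assumes \<Omega>: "open \<Omega>" "bounded \<Omega>" and sigma: "\<sigma> > 0"
    and f_convex: "convex_on {0..} f" and f_mono: "mono_on {0..} f"
    and f_d1: "\<And>s. s \<ge> 0 \<Longrightarrow> (f has_real_derivative f1 s) (at s within {0..})"
    and f1_cont: "continuous_on {0..} f1"
    and f_d2: "\<And>s. s > 0 \<Longrightarrow> (f1 has_real_derivative f2 s) (at s)"
    and f2_cont: "continuous_on {0<..} f2"
    and f1_flat: "\<And>s. 0 \<le> s \<Longrightarrow> s \<le> \<sigma> \<Longrightarrow> f1 s = 0"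
    and u_W: "u \<in> W1inf0 \<Omega>"
    and u_min: "\<And>v. v \<in> W1inf0 \<Omega> \<Longrightarrow> Jfun f \<Omega> u \<le> Jfun f \<Omega> v"
  shows "visc_solution (Gop f1 f2 \<sigma>) \<Omega> u"
  unfolding visc_solution_def
proof (intro conjI)
  obtain L where "L-lipschitz_on UNIV u" using u_W by (auto simp: W1inf0_def)
  then show "continuous_on \<Omega> u" using lipschitz_on_continuous_on continuous_on_subset by blast
  note above = minimizer_touched_from_above[OF \<Omega> sigma f_convex f_mono f_d1 f1_cont f_d2 f2_cont f1_flat]
  show "visc_sub (Gop f1 f2 \<sigma>) \<Omega> u"
    unfolding visc_sub_def
  proof (intro ballI allI impI, elim conjE)
    fix x0 \<phi> D H
    assume x0: "x0 \<in> \<Omega>" and C2: "C2_on \<Omega> \<phi> D H" and t: "u x0 = \<phi> x0" "\<forall>x\<in>\<Omega>. x \<noteq> x0 \<longrightarrow> u x < \<phi> x"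
    have "(if D x0 = 0 then - 1
     else - ((norm (D x0) * f2 (norm (D x0)) - f1 (norm (D x0))) / norm (D x0) ^ 3)
              * (D x0 \<bullet> (H x0 *v D x0))
          - (f1 (norm (D x0)) / norm (D x0)) * trace (H x0) - 1) \<le> 0"
    proof (rule above[OF _ _ _ _ u_W _ x0 C2 t(1)])
      show "set_lebesgue_integral lebesgue \<Omega> (\<lambda>x. f (norm (grad u x)) - 1 * u x)
        \<le> set_lebesgue_integral lebesgue \<Omega> (\<lambda>x. f (norm (grad v x)) - 1 * v x)" if "v \<in> W1inf0 \<Omega>" for v
        using u_min[OF that] by (simp add: Jfun_def)
    qed (use t in auto)
    then show "Gop f1 f2 \<sigma> (D x0) (H x0) \<le> 0" unfolding Gop_def by (rule min.coboundedI1)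
  qed
  show "visc_super (Gop f1 f2 \<sigma>) \<Omega> u"
    unfolding visc_super_def
  proof (intro ballI allI impI, elim conjE)
    fix x0 \<phi> D H
    assume x0: "x0 \<in> \<Omega>" and C2: "C2_on \<Omega> \<phi> D H" and t: "u x0 = \<phi> x0" "\<forall>x\<in>\<Omega>. x \<noteq> x0 \<longrightarrow> \<phi> x < u x"
    let ?P = "D x0"
    \<comment> \<open>Here \<open>c = -1\<close>, because \<open>-u\<close> minimizes the energy
      with the linear term reversed. The quadratic form and the trace change sign; at a vanishing
      gradient the claim reads \<open>1 \<le> 0\<close>, so \<open>?P\<close> is nonzero.\<close>
    have "(if - ?P = 0 then - (- 1)
     else - ((norm (- ?P) * f2 (norm (- ?P)) - f1 (norm (- ?P))) / norm (- ?P) ^ 3)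
              * (- ?P \<bullet> (- H x0 *v - ?P))
          - (f1 (norm (- ?P)) / norm (- ?P)) * trace (- H x0) - (- 1)) \<le> 0"
    proof (rule above[OF _ _ _ _ W1inf0_uminus[OF u_W] _ x0 C2_on_uminus[OF C2]])
      fix v assume "v \<in> W1inf0 \<Omega>"
      from u_min[OF W1inf0_uminus[OF this]]
      show "set_lebesgue_integral lebesgue \<Omega> (\<lambda>x. f (norm (grad (\<lambda>x. - u x) x)) - - 1 * - u x)
        \<le> set_lebesgue_integral lebesgue \<Omega> (\<lambda>x. f (norm (grad v x)) - - 1 * v x)"
        by (simp add: Jfun_def grad_uminus)
    qed (use t in auto)
    moreover have "trace (- H x0) = - trace (H x0)" by (simp add: trace_def sum_negf)
    moreover have "- H x0 *v - ?P = H x0 *v ?P"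
      by (simp add: matrix_vector_mult_def vec_eq_iff)
    ultimately have P: "?P \<noteq> 0"
      and first: "0 \<le> - ((norm ?P * f2 (norm ?P) - f1 (norm ?P)) / norm ?P ^ 3) * (?P \<bullet> (H x0 *v ?P))
          - (f1 (norm ?P) / norm ?P) * trace (H x0) - 1"
      by (auto split: if_splits)
    have "\<sigma> \<le> norm ?P"
    proof (rule ccontr)
      assume "\<not> \<sigma> \<le> norm ?P"
      then have s: "norm ?P \<in> {0<..<\<sigma>}" using P by simp
      \<comment> \<open>Strictly below \<sigma> the function \<open>f1\<close> is locally 0, so
        \<open>f2\<close> vanishes by uniqueness of derivatives and the first entry is -1.\<close>
      have "(f1 has_real_derivative 0) (at (norm ?P))"
        by (rule has_field_derivative_transform_within_open[OF DERIV_const[of 0] open_greaterThanLessThan s])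
           (use f1_flat in auto)
      then have "f2 (norm ?P) = 0" using f_d2[of "norm ?P"] s DERIV_unique by auto
      then show False using first f1_flat[of "norm ?P"] s by simp
    qed
    then show "0 \<le> Gop f1 f2 \<sigma> (D x0) (H x0)" using P first by (simp add: Gop_def)
  qed
qed

theorem theorem3p2:
  fixes \<Omega> :: "(real^'n) set" and \<alpha> \<sigma> :: real
    and f f1 f2 f3 :: "real \<Rightarrow> real"
    and fn fn1 fn2 fn3 :: "nat \<Rightarrow> real \<Rightarrow> real"
    and u :: "real^'n \<Rightarrow> real"
  assumes dim: "CARD('n) \<ge> 2"
    and dom: "open \<Omega>" "connected \<Omega>" "bounded \<Omega>" "\<Omega> \<noteq> {}"
    and alpha: "0 < \<alpha>" "\<alpha> < 1"
    and bdry: "C2alpha_boundary \<Omega> \<alpha>"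
    \<comment> \<open>standing assumptions (A), plus f in C^2((0,+infinity))\<close>
    and sigma: "\<sigma> > 0"
    and f_convex: "convex_on {0..} f"
    and f_mono: "mono_on {0..} f"
    and f_d1: "\<And>s. s \<ge> 0 \<Longrightarrow> (f has_real_derivative f1 s) (at s within {0..})"
    and f1_cont: "continuous_on {0..} f1"
    and f_d2: "\<And>s. s > 0 \<Longrightarrow> (f1 has_real_derivative f2 s) (at s)"
    and f2_cont: "continuous_on {0<..} f2"
    and f_d3: "\<And>s. s > \<sigma> \<Longrightarrow> (f2 has_real_derivative f3 s) (at s)"
    and f3_cont: "continuous_on {\<sigma><..} f3"
    and f0: "f 0 = 0"
    and f_superlin: "filterlim (\<lambda>s. f s / s) at_top at_top"
    and f1_flat: "\<And>s. 0 \<le> s \<Longrightarrow> s \<le> \<sigma> \<Longrightarrow> f1 s = 0"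
    and f2_pos: "\<And>s. s > \<sigma> \<Longrightarrow> f2 s > 0"
    \<comment> \<open>u is the minimizer of J over W^{1,infinity}_0\<close>
    and u_W: "u \<in> W1inf0 \<Omega>"
    and u_min: "\<And>v. v \<in> W1inf0 \<Omega> \<Longrightarrow> Jfun f \<Omega> u \<le> Jfun f \<Omega> v"
    \<comment> \<open>approximating sequence\<close>
    and fn_convex: "\<And>n. convex_on {0..} (fn n)"
    and fn0: "\<And>n. fn n 0 = 0"
    and fn_superlin: "\<And>n. filterlim (\<lambda>s. fn n s / s) at_top at_top"
    and fn_d1: "\<And>n s. s \<ge> 0 \<Longrightarrow> (fn n has_real_derivative fn1 n s) (at s within {0..})"
    and fn1_cont: "\<And>n. continuous_on {0..} (fn1 n)"
    and fn_d2: "\<And>n s. s > 0 \<Longrightarrow> (fn1 n has_real_derivative fn2 n s) (at s)"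
    and fn2_cont: "\<And>n. continuous_on {0<..} (fn2 n)"
    and fn_d3: "\<And>n s. s > 0 \<Longrightarrow> (fn2 n has_real_derivative fn3 n s) (at s)"
    and fn3_cont: "\<And>n. continuous_on {0<..} (fn3 n)"
    and ii: "\<And>K. compact K \<Longrightarrow> K \<subseteq> {0..} \<Longrightarrow> uniform_limit K fn f sequentially"
    and iii_0: "\<And>n. fn1 n 0 = 0"
    and iii_dec: "\<And>n s. s \<ge> 0 \<Longrightarrow> fn1 (Suc n) s \<le> fn1 n s"
    and iii_lim: "\<And>K. compact K \<Longrightarrow> K \<subseteq> {0..} \<Longrightarrow> uniform_limit K fn1 f1 sequentially"
    and iv: "\<And>n s. s > 0 \<Longrightarrow> fn2 n s > 0"
    and v1: "\<And>n. ((\<lambda>s. (s * fn2 n s - fn1 n s) / s ^ 3) \<longlongrightarrow> 0) (at_right 0)"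
    and v2: "\<And>n. ((\<lambda>s. fn1 n s / s) \<longlongrightarrow> 0) (at_right 0)"
    and vi1: "\<And>K. compact K \<Longrightarrow> K \<subseteq> {0..<\<sigma>} \<Longrightarrow>
               uniform_limit K (\<lambda>n s. if s = 0 then 0 else (s * fn2 n s - fn1 n s) / s ^ 3)
                 (\<lambda>s. 0) sequentially"
    and vi2: "\<And>K. compact K \<Longrightarrow> K \<subseteq> {0..<\<sigma>} \<Longrightarrow>
               uniform_limit K (\<lambda>n s. if s = 0 then 0 else fn1 n s / s) (\<lambda>s. 0) sequentially"
    and vii: "\<And>K. compact K \<Longrightarrow> K \<subseteq> {0<..} \<Longrightarrow> uniform_limit K fn2 f2 sequentially"
  shows "visc_solution (Gop f1 f2 \<sigma>) \<Omega> u"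
  by (rule minimizer_visc_solution[OF dom(1,3) sigma f_convex f_mono f_d1 f1_cont f_d2 f2_cont
        f1_flat u_W u_min])

end
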